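(* For every finite labeled graph $F$ with $|V(F)| \geq 3$ and for all $p \in (0,1)$, $$I(F,p) > \operatorname{rand}(F,p).$$
   Context: Graphs are finite and simple. For a graph $G$, the edge density is $\rho(G) = |E(G)|/\binom{|V(G)|}{2}$. For finite labeled graphs $F, G$, let $$N(F,G) = \left|\{\phi : V(F) \hookrightarrow V(G) \text{ injective} : (a,b) \in E(F) \iff (\phi(a),\phi(b)) \in E(G)\}\right|$$ and define the induced $F$-density of $G$ to be $\rho(F,G) = N(F,G)/(|V(G)|)_{|V(F)|}$, where $(x)_k = x(x-1)\cdots(x-(k-1))$. For $p \in [0,1]$ define $$I(F,p) = \sup\Big\{y : \exists\, \{G_n\}_{n\geq 1},\ \lim_{n\to\infty} |V(G_n)| = \infty,\ \lim_{n\to\infty}\rho(G_n) = p,\ \lim_{n\to\infty}\rho(F,G_n) = y\Big\},$$ where $\{G_n\}$ ranges over sequences of finite labeled graphs. Finally, $$\operatorname{rand}(F,p) = p^{|E(F)|}(1-p)^{\binom{|V(F)|}{2}-|E(F)|}.$$ *)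

theory Defs
  imports Complex_Main "HOL-Library.FuncSet" "HOL-Library.Ramsey"
begin

record 'a graph =
  verts :: "'a set"
  edges :: "'a set set"

text \<open>Edges are unordered pairs of distinct vertices: \<^term>\<open>nsets V 2\<close> is the set of
  two-element subsets of \<^term>\<open>V\<close>.\<close>

definition finite_simple_graph :: "'a graph \<Rightarrow> bool" where
  "finite_simple_graph G \<longleftrightarrow> finite (verts G) \<and> edges G \<subseteq> nsets (verts G) 2"

definition edge_density :: "'a graph \<Rightarrow> real" where
  "edge_density G = real (card (edges G)) / real (card (verts G) choose 2)"

text \<open>Maps from \<^term>\<open>verts F\<close> to \<^term>\<open>verts G\<close> are taken to be extensional (that is,
  undefined outside \<^term>\<open>verts F\<close>), so that each is counted exactly once. For \<open>a = b\<close> the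
  edge condition holds trivially, since singletons are never edges.\<close>

definition induced_embeddings :: "'a graph \<Rightarrow> 'b graph \<Rightarrow> ('a \<Rightarrow> 'b) set" where
  "induced_embeddings F G =
     {\<phi> \<in> verts F \<rightarrow>\<^sub>E verts G. inj_on \<phi> (verts F) \<and>
        (\<forall>a\<in>verts F. \<forall>b\<in>verts F. {a, b} \<in> edges F \<longleftrightarrow> {\<phi> a, \<phi> b} \<in> edges G)}"

definition falling_factorial :: "real \<Rightarrow> nat \<Rightarrow> real" where
  "falling_factorial x k = (\<Prod>i<k. x - real i)"

definition induced_density :: "'a graph \<Rightarrow> 'b graph \<Rightarrow> real" where
  "induced_density F G = real (card (induced_embeddings F G)) /
     falling_factorial (real (card (verts G))) (card (verts F))"

text \<open>The graphs \<open>G\<^sub>n\<close> have natural numbers as vertices; every finite graph is isomorphic to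
  such a graph. For \<open>0 \<le> p \<le> 1\<close> and a finite simple graph \<open>F\<close>, the set of limits below is a
  nonempty (by compactness) subset of \<open>[0, 1]\<close>, so the real \<^const>\<open>Sup\<close> is a genuine least
  upper bound.\<close>

definition limit_induced_densities :: "'a graph \<Rightarrow> real \<Rightarrow> real set" where
  "limit_induced_densities F p =
     {y. \<exists>G :: nat \<Rightarrow> nat graph.
           (\<forall>n. finite_simple_graph (G n)) \<and>
           filterlim (\<lambda>n. card (verts (G n))) at_top sequentially \<and>
           (\<lambda>n. edge_density (G n)) \<longlonglongrightarrow> p \<and>
           (\<lambda>n. induced_density F (G n)) \<longlonglongrightarrow> y}"

definition inducibility :: "'a graph \<Rightarrow> real \<Rightarrow> real" where
  "inducibility F p = Sup (limit_induced_densities F p)"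

definition rand_density :: "'a graph \<Rightarrow> real \<Rightarrow> real" where
  "rand_density F p =
     p ^ card (edges F) * (1 - p) ^ ((card (verts F) choose 2) - card (edges F))"

end

theory Submission
  imports Defs "HOL-Computational_Algebra.Primes"
begin

text \<open>
  Write \<open>k\<close> for the number of vertices of \<open>F\<close> and consider random graphs in which a vertex of
  type \<open>x\<close> is joined to one of type \<open>y\<close> with probability \<open>p + U(x, y)\<close>, where \<open>U\<close> is a small symmetric
  perturbation of mean zero. Up to the factor \<open>rand(F, p)\<close>, the induced density of \<open>F\<close> is the mean of
  \<open>\<Prod>(1 + c\<^sub>i\<^sub>j U(x\<^sub>i, x\<^sub>j))\<close> over the pairs \<open>ij\<close> of vertices of \<open>F\<close>, where \<open>c\<^sub>i\<^sub>j\<close> is \<open>1/p\<close> for edges and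
  \<open>-1/(1 - p)\<close> for non-edges. Expanding the product gives one term for every set of pairs, i.e. for
  every subgraph \<open>H\<close> of the complete graph \<open>K\<^sub>k\<close>. The combined coefficients of small \<open>H\<close> (paths of length
  two, triangles, 4-cycles) may vanish or have the wrong sign, depending on \<open>F\<close> and \<open>p\<close>. The term
  for \<open>H = K\<^sub>k\<close> is different: there is only one such term and its coefficient is never zero. So it
  suffices to find \<open>U\<close> for which this term dominates all others and has a sign that can be prescribed.

  A quadratic phase does this. Let \<open>r\<close> be a large prime, let the types be the residues modulo \<open>r\<close>, let
  \<open>\<chi>\<close> be an additive character, and let \<open>U\<close> be a multiple of the real part of
  \<open>\<omega> \<chi>(x\<^sup>2 + y\<^sup>2 + 2(k - 1)xy)\<close> with \<open>|\<omega>| = 1\<close>. Multiplied over all pairs, the phases add up to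
  \<open>(k - 1)(x\<^sub>1 + \<dots> + x\<^sub>k)\<^sup>2\<close>, a form of rank one, whose mean is a Gauss sum of size \<open>r\<^sup>-\<^sup>1\<^sup>/\<^sup>2\<close>
  (\<open>sum_pair_form\<close>, \<open>norm_gauss_sum\<close>). The product of all the conjugates is the conjugate of this one.
  Every other nonempty product of phases and conjugates, at most one for each pair, has
  a nonsingular 2 by 2 minor (\<open>nonsingular_minor_exists\<close>), so that its mean is at most \<open>1/r\<close>
  (\<open>norm_sum_unit_char_quadratic_2\<close>). As \<open>k \<ge> 3\<close>, this includes a single edge, so that \<open>U\<close> has mean
  \<open>O(1/r)\<close>, which can be subtracted. Choosing \<open>\<omega>\<close> so that the main term is positive, the gain
  of order \<open>r\<^sup>-\<^sup>1\<^sup>/\<^sup>2\<close> exceeds the errors of order \<open>1/r\<close> when \<open>r\<close> is large (\<open>tilted_kernel_exists\<close>).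

  Finally \<open>r\<close> is fixed and the number of vertices tends to infinity. An averaging argument that
  penalises deviations of the edge density replaces the edge probabilities by an actual graph with
  edge density close to \<open>p\<close> (\<open>weighted_graph_rounding\<close>), and a subsequence of these graphs has convergent
  induced densities.
\<close>

section \<open>Quadratic exponential sums\<close>

text \<open>The additive character of the integers modulo \<open>r\<close>, as a function on all integers.\<close>

definition unit_char :: "nat \<Rightarrow> int \<Rightarrow> complex" where
  "unit_char r z = cis (2 * pi * of_int z / real r)"

lemma unit_char_0 [simp]: "unit_char r 0 = 1"
  by (simp add: unit_char_def)

lemma unit_char_add: "unit_char r (a + b) = unit_char r a * unit_char r b"
  by (simp add: unit_char_def cis_mult ring_distribs add_divide_distrib)

lemma norm_unit_char [simp]: "norm (unit_char r a) = 1"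
  by (simp add: unit_char_def)

lemma unit_char_uminus: "unit_char r (- a) = cnj (unit_char r a)"
  by (simp add: unit_char_def cis_cnj)

lemma unit_char_diff: "unit_char r (a - b) = unit_char r a * cnj (unit_char r b)"
  using unit_char_add[of r a "- b"] by (simp add: unit_char_uminus)

lemma unit_char_mult_nat: "unit_char r (a * int n) = unit_char r a ^ n"
  by (simp add: unit_char_def Complex.DeMoivre mult_ac)

lemma unit_char_sum: "unit_char r (sum f I) = (\<Prod>i\<in>I. unit_char r (f i))"
  by (induction I rule: infinite_finite_induct) (simp_all add: unit_char_add)

lemma unit_char_eq_1_iff:
  assumes "r > 0"
  shows "unit_char r a = 1 \<longleftrightarrow> int r dvd a"
proof
  assume "int r dvd a"
  then obtain c where "a = int r * c" by blast
  then have "unit_char r a = cis (2 * pi * of_int c)"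
    using assms by (simp add: unit_char_def mult.assoc[symmetric])
  then show "unit_char r a = 1" by simp
next
  assume "unit_char r a = 1"
  then have "cos (2 * pi * of_int a / real r) = 1"
    by (simp add: unit_char_def complex_eq_iff)
  then obtain c :: int where "2 * pi * of_int a / real r = of_int c * 2 * pi"
    by (auto simp: cos_one_2pi_int)
  then have "real_of_int a = of_int (c * int r)"
    using assms by (simp add: field_simps)
  then have "a = c * int r" by linarith
  then show "int r dvd a" by simp
qed

lemma unit_char_periodic: "r > 0 \<Longrightarrow> int r dvd a - b \<Longrightarrow> unit_char r a = unit_char r b"
  using unit_char_add[of r "a - b" b] by (simp add: unit_char_eq_1_iff)

lemma sum_unit_char_linear:
  assumes "r > 0"
  shows "(\<Sum>u<r. unit_char r (l * int u)) = (if int r dvd l then of_nat r else 0)"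
proof (cases "int r dvd l")
  case True
  then have "unit_char r l = 1" by (simp add: unit_char_eq_1_iff[OF assms])
  then show ?thesis using True by (simp add: unit_char_mult_nat)
next
  case False
  then have "unit_char r l \<noteq> 1" by (simp add: unit_char_eq_1_iff[OF assms])
  moreover have "unit_char r l ^ r = 1"
    by (simp flip: unit_char_mult_nat add: unit_char_eq_1_iff[OF assms])
  ultimately show ?thesis
    using False by (simp add: unit_char_mult_nat geometric_sum)
qed

lemma sum_periodic_shift:
  fixes g :: "int \<Rightarrow> 'b :: comm_monoid_add"
  assumes "r > 0" and per: "\<And>a b. int r dvd a - b \<Longrightarrow> g a = g b"
  shows "(\<Sum>u<r. g (int u + h)) = (\<Sum>u<r. g (int u))"
proof (rule sum.reindex_bij_witness[where i = "\<lambda>u. nat ((int u - h) mod int r)"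
      and j = "\<lambda>u. nat ((int u + h) mod int r)"])
  fix u assume "u \<in> {..<r}"
  then have u: "u < r" by simp
  have "((int u + h) mod int r - h) mod int r = int u"
    using u by (simp add: mod_diff_left_eq)
  then show "nat ((int (nat ((int u + h) mod int r)) - h) mod int r) = u"
    using assms(1) by simp
  have "((int u - h) mod int r + h) mod int r = int u"
    using u by (simp add: mod_add_left_eq)
  then show "nat ((int (nat ((int u - h) mod int r)) + h) mod int r) = u"
    using assms(1) by simp
  show "nat ((int u + h) mod int r) \<in> {..<r}" "nat ((int u - h) mod int r) \<in> {..<r}"
    using assms(1) by (auto simp: nat_less_iff)
  show "g (int (nat ((int u + h) mod int r))) = g (int u + h)"
    using assms(1) by (intro per) (simp add: mod_eq_dvd_iff flip: mod_eq_dvd_iff)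
qed

lemma sum_periodic_blocks:
  fixes g :: "int \<Rightarrow> 'b :: semiring_1"
  assumes per: "\<And>a b. int r dvd a - b \<Longrightarrow> g a = g b"
  shows "(\<Sum>u<n * r. g (int u)) = of_nat n * (\<Sum>u<r. g (int u))"
proof -
  have "(\<Sum>u<n * r. g (int u)) = (\<Sum>m<n. \<Sum>u=m*r..<m*r+r. g (int u))"
    by (rule sum.nat_group[symmetric])
  also have "\<dots> = (\<Sum>m<n. \<Sum>u<r. g (int u))"
  proof (rule sum.cong[OF refl])
    fix m
    have "(\<Sum>u=m*r..<m*r+r. g (int u)) = (\<Sum>u<r. g (int (u + m * r)))"
      using sum.shift_bounds_nat_ivl[of "\<lambda>u. g (int u)" 0 "m * r" r]
      by (simp add: add.commute lessThan_atLeast0)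
    also have "\<dots> = (\<Sum>u<r. g (int u))"
      by (intro sum.cong refl per) simp
    finally show "(\<Sum>u=m*r..<m*r+r. g (int u)) = (\<Sum>u<r. g (int u))" .
  qed
  finally show ?thesis by simp
qed

lemma unit_char_quadratic_periodic:
  assumes "r > 0" "int r dvd h - h'" "int r dvd k - k'"
  shows "unit_char r (a * h\<^sup>2 + b * k\<^sup>2 + 2 * c * h * k + l * h + l' * k + d) =
    unit_char r (a * h'\<^sup>2 + b * k'\<^sup>2 + 2 * c * h' * k' + l * h' + l' * k' + d)"
proof (rule unit_char_periodic[OF assms(1)])
  from assms(2,3) obtain s t where "h - h' = int r * s" "k - k' = int r * t" by blast
  then have h: "h = h' + int r * s" and k: "k = k' + int r * t" by simp_all
  have "(a * h\<^sup>2 + b * k\<^sup>2 + 2 * c * h * k + l * h + l' * k + d) -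
      (a * h'\<^sup>2 + b * k'\<^sup>2 + 2 * c * h' * k' + l * h' + l' * k' + d) =
      int r * (a * (2 * h' * s + int r * s\<^sup>2) + b * (2 * k' * t + int r * t\<^sup>2)
        + 2 * c * (h' * t + k' * s + int r * s * t) + l * s + l' * t)"
    unfolding h k by (simp add: algebra_simps power2_eq_square)
  then show "int r dvd (a * h\<^sup>2 + b * k\<^sup>2 + 2 * c * h * k + l * h + l' * k + d) -
      (a * h'\<^sup>2 + b * k'\<^sup>2 + 2 * c * h' * k' + l * h' + l' * k' + d)" by simp
qed

text \<open>
  Weyl differencing: in \<open>|S|\<^sup>2\<close> the difference of the phases at two points with displacement \<open>(h, k)\<close>
  is linear in the base point, and its sum vanishes unless both linear coefficients are zero modulo
  \<open>r\<close>. As the form is nonsingular, this leaves only the zero displacement.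
\<close>

lemma norm_sum_unit_char_quadratic_2:
  assumes "prime r" "odd r" and disc: "\<not> int r dvd a * b - c\<^sup>2"
  shows "norm (\<Sum>u<r. \<Sum>v<r. unit_char r
           (a * (int u)\<^sup>2 + b * (int v)\<^sup>2 + 2 * c * int u * int v + l * int u + l' * int v + d)) = real r"
proof -
  have r: "r > 0" using assms(1) by (simp add: prime_gt_0_nat)
  define Q where "Q = (\<lambda>u v. a * u\<^sup>2 + b * v\<^sup>2 + 2 * c * u * v + l * u + l' * v + d :: int)"
  define S where "S = (\<Sum>u<r. \<Sum>v<r. unit_char r (Q (int u) (int v)))"
  define Z where "Z = (\<lambda>h k. Q h k - d)"
  have perQ: "unit_char r (Q h k) = unit_char r (Q h' k')"
    if "int r dvd h - h'" "int r dvd k - k'" for h k h' k'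
    unfolding Q_def by (rule unit_char_quadratic_periodic[OF r that])
  have per1: "unit_char r (Q h k) = unit_char r (Q h' k)" if "int r dvd h - h'" for h h' k
    using perQ[of h h' k k] that by simp
  have per2: "unit_char r (Q h k) = unit_char r (Q h k')" if "int r dvd k - k'" for h k k'
    using perQ[of h h k k'] that by simp
  have swap: "(\<Sum>u<r. \<Sum>v<r. \<Sum>h<r. \<Sum>k<r. f u v h k) = (\<Sum>h<r. \<Sum>k<r. \<Sum>u<r. \<Sum>v<r. f u v h k)"
    for f :: "nat \<Rightarrow> nat \<Rightarrow> nat \<Rightarrow> nat \<Rightarrow> complex"
  proof -
    have "(\<Sum>u<r. \<Sum>v<r. \<Sum>h<r. \<Sum>k<r. f u v h k) = (\<Sum>u<r. \<Sum>h<r. \<Sum>v<r. \<Sum>k<r. f u v h k)"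
      by (rule sum.cong[OF refl]) (rule sum.swap)
    also have "\<dots> = (\<Sum>h<r. \<Sum>u<r. \<Sum>v<r. \<Sum>k<r. f u v h k)"
      by (rule sum.swap)
    also have "\<dots> = (\<Sum>h<r. \<Sum>u<r. \<Sum>k<r. \<Sum>v<r. f u v h k)"
      by (rule sum.cong[OF refl], rule sum.cong[OF refl]) (rule sum.swap)
    also have "\<dots> = (\<Sum>h<r. \<Sum>k<r. \<Sum>u<r. \<Sum>v<r. f u v h k)"
      by (rule sum.cong[OF refl]) (rule sum.swap)
    finally show ?thesis .
  qed
  have factor: "(\<Sum>u<r. \<Sum>v<r. z * (f u * g v)) = z * ((\<Sum>u<r. f u) * (\<Sum>v<r. g v))"
    for z and f g :: "nat \<Rightarrow> complex"
    by (subst sum_product) (simp only: sum_distrib_left)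
  have zero: "h = 0 \<and> k = 0"
    if hk: "h < r" "k < r" "int r dvd 2 * (a * int h + c * int k)" "int r dvd 2 * (c * int h + b * int k)"
    for h k
  proof -
    have pr: "prime (int r)" using assms(1) by simp
    have "coprime (int r) 2"
      using assms(2) by simp
    then have 1: "int r dvd a * int h + c * int k" "int r dvd c * int h + b * int k"
      using hk(3,4) coprime_dvd_mult_right_iff by blast+
    have "int r dvd b * (a * int h + c * int k) - c * (c * int h + b * int k)"
      "int r dvd a * (c * int h + b * int k) - c * (a * int h + c * int k)"
      using 1 by simp_all
    then have "int r dvd (a * b - c\<^sup>2) * int h" "int r dvd (a * b - c\<^sup>2) * int k"
      by (simp_all add: algebra_simps power2_eq_square)
    then have "int r dvd int h" "int r dvd int k"
      using disc pr by (simp_all add: prime_dvd_mult_iff)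
    then show ?thesis using hk(1,2) by (auto dest: dvd_imp_le)
  qed
  have diff: "Q (int h + int u) (int k + int v) - Q (int u) (int v) =
      Z (int h) (int k) + (2 * (a * int h + c * int k)) * int u + (2 * (c * int h + b * int k)) * int v" for h k u v
    unfolding Q_def Z_def by (simp add: algebra_simps power2_eq_square)
  have "S * cnj S = (\<Sum>u<r. \<Sum>v<r. \<Sum>h<r. \<Sum>k<r. unit_char r (Q (int h) (int k)) * cnj (unit_char r (Q (int u) (int v))))"
    unfolding S_def cnj_sum by (simp add: sum_distrib_left sum_distrib_right)
  also have "\<dots> = (\<Sum>u<r. \<Sum>v<r. \<Sum>h<r. \<Sum>k<r. unit_char r (Q (int h + int u) (int k + int v) - Q (int u) (int v)))"
  proof (rule sum.cong[OF refl], rule sum.cong[OF refl])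
    fix u v
    define C where "C = cnj (unit_char r (Q (int u) (int v)))"
    have "(\<Sum>h<r. \<Sum>k<r. unit_char r (Q (int h + int u) (int k + int v) - Q (int u) (int v)))
        = (\<Sum>h<r. \<Sum>k<r. unit_char r (Q (int h + int u) (int k + int v)) * C)"
      by (simp add: unit_char_diff C_def)
    also have "\<dots> = (\<Sum>h<r. \<Sum>k<r. unit_char r (Q (int h + int u) (int k)) * C)"
      by (intro sum.cong refl sum_periodic_shift[OF r]) (simp add: per2)
    also have "\<dots> = (\<Sum>h<r. \<Sum>k<r. unit_char r (Q (int h) (int k)) * C)"
      using sum_periodic_shift[OF r, of "\<lambda>h. \<Sum>k<r. unit_char r (Q h (int k)) * C" "int u"]
      by (simp add: per1 cong: sum.cong)
    finally show "(\<Sum>h<r. \<Sum>k<r. unit_char r (Q (int h) (int k)) * cnj (unit_char r (Q (int u) (int v)))) =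
       (\<Sum>h<r. \<Sum>k<r. unit_char r (Q (int h + int u) (int k + int v) - Q (int u) (int v)))"
      by (simp add: C_def)
  qed
  also have "\<dots> = (\<Sum>u<r. \<Sum>v<r. \<Sum>h<r. \<Sum>k<r. unit_char r (Z (int h) (int k)) *
      (unit_char r ((2 * (a * int h + c * int k)) * int u) * unit_char r ((2 * (c * int h + b * int k)) * int v)))"
    by (simp only: diff unit_char_add mult.assoc)
  also have "\<dots> = (\<Sum>h<r. \<Sum>k<r. \<Sum>u<r. \<Sum>v<r. unit_char r (Z (int h) (int k)) *
      (unit_char r ((2 * (a * int h + c * int k)) * int u) * unit_char r ((2 * (c * int h + b * int k)) * int v)))"
    by (rule swap)
  also have "\<dots> = (\<Sum>h<r. \<Sum>k<r. unit_char r (Z (int h) (int k)) *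
      ((\<Sum>u<r. unit_char r ((2 * (a * int h + c * int k)) * int u)) *
       (\<Sum>v<r. unit_char r ((2 * (c * int h + b * int k)) * int v))))"
    by (simp only: factor)
  also have "\<dots> = (\<Sum>h<r. \<Sum>k<r. if h = 0 \<and> k = 0 then of_nat (r ^ 2) else 0)"
  proof (intro sum.cong refl)
    fix h k assume "h \<in> {..<r}" "k \<in> {..<r}"
    then show "unit_char r (Z (int h) (int k)) *
      ((\<Sum>u<r. unit_char r ((2 * (a * int h + c * int k)) * int u)) *
       (\<Sum>v<r. unit_char r ((2 * (c * int h + b * int k)) * int v))) = (if h = 0 \<and> k = 0 then of_nat (r ^ 2) else 0)"
      using zero[of h k] unfolding sum_unit_char_linear[OF r]
      by (auto simp: Z_def Q_def power2_eq_square)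
  qed
  also have "\<dots> = (\<Sum>h<r. if h = 0 then of_nat (r ^ 2) else 0)"
    using r by (intro sum.cong refl) auto
  also have "\<dots> = of_nat (r ^ 2)" using r by simp
  finally have SS: "S * cnj S = of_nat (r ^ 2)" .
  have "complex_of_real ((norm S)\<^sup>2) = complex_of_real ((real r)\<^sup>2)"
    unfolding complex_norm_square SS by simp
  then have "norm S = real r"
    by (simp only: of_real_eq_iff) (simp add: power2_eq_iff_nonneg)
  then show ?thesis unfolding S_def Q_def .
qed

lemma norm_sum_unit_char_quadratic_2_blocks:
  assumes "prime r" "odd r" and disc: "\<not> int r dvd a * b - c\<^sup>2"
  shows "norm (\<Sum>u<n * r. \<Sum>v<n * r. unit_char r
           (a * (int u)\<^sup>2 + b * (int v)\<^sup>2 + 2 * c * int u * int v + l * int u + l' * int v + d))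
         = real n ^ 2 * real r"
proof -
  have r: "r > 0" using assms(1) by (simp add: prime_gt_0_nat)
  define g where "g = (\<lambda>u v. unit_char r (a * u\<^sup>2 + b * v\<^sup>2 + 2 * c * u * v + l * u + l' * v + d))"
  have 1: "g u v = g u v'" if "int r dvd v - v'" for u v v'
    unfolding g_def using that by (intro unit_char_quadratic_periodic r) auto
  have 2: "g u v = g u' v" if "int r dvd u - u'" for u u' v
    unfolding g_def using that by (intro unit_char_quadratic_periodic r) auto
  have "(\<Sum>u<n * r. \<Sum>v<n * r. g (int u) (int v)) = (\<Sum>u<n * r. of_nat n * (\<Sum>v<r. g (int u) (int v)))"
    by (intro sum.cong refl sum_periodic_blocks 1)
  also have "\<dots> = of_nat n * (\<Sum>u<n * r. \<Sum>v<r. g (int u) (int v))"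
    by (simp add: sum_distrib_left)
  also have "(\<Sum>u<n * r. \<Sum>v<r. g (int u) (int v)) = of_nat n * (\<Sum>u<r. \<Sum>v<r. g (int u) (int v))"
    by (rule sum_periodic_blocks) (intro sum.cong refl 2)
  finally have "norm (\<Sum>u<n * r. \<Sum>v<n * r. g (int u) (int v)) =
      real n * (real n * norm (\<Sum>u<r. \<Sum>v<r. g (int u) (int v)))"
    by (simp add: norm_mult)
  also have "norm (\<Sum>u<r. \<Sum>v<r. g (int u) (int v)) = real r"
    unfolding g_def by (rule norm_sum_unit_char_quadratic_2[OF assms])
  finally show ?thesis by (simp add: g_def power2_eq_square mult.assoc)
qed

text \<open>
  The squared modulus of the Gauss sum is the double sum for the form \<open>a u\<^sup>2 - a v\<^sup>2\<close>, which is
  nonsingular.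
\<close>

lemma norm_gauss_sum:
  assumes "prime r" "odd r" "\<not> int r dvd a"
  shows "norm (\<Sum>u<r. unit_char r (a * (int u)\<^sup>2)) = sqrt (real r)"
proof -
  define G where "G = (\<Sum>u<r. unit_char r (a * (int u)\<^sup>2))"
  have nd: "\<not> int r dvd a * (- a) - 0\<^sup>2"
    using assms(1,3) by (simp add: prime_dvd_mult_iff)
  have "G * cnj G = (\<Sum>u<r. \<Sum>v<r. unit_char r
           (a * (int u)\<^sup>2 + (- a) * (int v)\<^sup>2 + 2 * 0 * int u * int v + 0 * int u + 0 * int v + 0))"
    unfolding G_def cnj_sum sum_product by (simp flip: unit_char_diff)
  then have "norm (G * cnj G) = real r"
    using norm_sum_unit_char_quadratic_2[OF assms(1,2) nd, of 0 0 0] by metis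
  then have "(norm G)\<^sup>2 = real r" by (simp add: norm_mult power2_eq_square)
  then show ?thesis unfolding G_def by (metis norm_ge_zero real_sqrt_unique)
qed

section \<open>A quadratic form on the pairs of a finite set\<close>

lemma sum_ordered_pairs:
  fixes f :: "'a set \<Rightarrow> 'b :: comm_semiring_1"
  assumes "finite V"
  shows "(\<Sum>a\<in>V. \<Sum>b\<in>V - {a}. f {a, b}) = 2 * (\<Sum>e\<in>nsets V 2. f e)"
  using assms
proof (induction V rule: finite_induct)
  case empty
  then show ?case by (simp add: nsets_eq_empty)
next
  case (insert v V)
  have nsets: "nsets (insert v V) 2 = nsets V 2 \<union> (\<lambda>b. {v, b}) ` V"
    using insert.hyps(2) by (auto simp: nsets_2_eq)
  have "(\<Sum>e\<in>nsets (insert v V) 2. f e) = (\<Sum>e\<in>nsets V 2. f e) + (\<Sum>e\<in>(\<lambda>b. {v, b}) ` V. f e)"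
    unfolding nsets using insert.hyps
    by (intro sum.union_disjoint) (auto simp: finite_imp_finite_nsets nsets_def)
  also have "(\<Sum>e\<in>(\<lambda>b. {v, b}) ` V. f e) = (\<Sum>b\<in>V. f {v, b})"
    using insert.hyps(2) by (subst sum.reindex) (auto simp: inj_on_def doubleton_eq_iff)
  finally have 1: "(\<Sum>e\<in>nsets (insert v V) 2. f e) = (\<Sum>e\<in>nsets V 2. f e) + (\<Sum>b\<in>V. f {v, b})" .
  have 2: "(\<Sum>b\<in>insert v V - {a}. f {a, b}) = f {v, a} + (\<Sum>b\<in>V - {a}. f {a, b})" if "a \<in> V" for a
  proof -
    have "insert v V - {a} = insert v (V - {a})" using that insert.hyps(2) by auto
    then show ?thesis using insert.hyps by (simp add: insert_commute)
  qed
  have "(\<Sum>a\<in>insert v V. \<Sum>b\<in>insert v V - {a}. f {a, b})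
      = (\<Sum>b\<in>V. f {v, b}) + (\<Sum>a\<in>V. f {v, a} + (\<Sum>b\<in>V - {a}. f {a, b}))"
    using insert.hyps by (simp add: 2)
  also have "\<dots> = 2 * ((\<Sum>e\<in>nsets V 2. f e) + (\<Sum>b\<in>V. f {v, b}))"
    by (simp add: sum.distrib insert.IH distrib_left mult_2 add_ac)
  finally show ?case by (simp only: 1)
qed

lemma sum_pairs_containing:
  assumes "finite V" "i \<in> V"
  shows "(\<Sum>e\<in>nsets V 2. if i \<in> e then f e else 0) = (\<Sum>b\<in>V - {i}. f {i, b} :: 'b :: comm_monoid_add)"
proof -
  have eq: "{e \<in> nsets V 2. i \<in> e} = (\<lambda>b. {i, b}) ` (V - {i})"
    using assms(2) by (auto simp: nsets_2_eq)
  have "(\<Sum>e\<in>nsets V 2. if i \<in> e then f e else 0) = (\<Sum>e\<in>{e \<in> nsets V 2. i \<in> e}. f e)"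
    using assms(1) by (intro sum.inter_filter[symmetric] finite_imp_finite_nsets)
  also have "\<dots> = (\<Sum>b\<in>V - {i}. f {i, b})"
    unfolding eq by (subst sum.reindex) (auto simp: inj_on_def doubleton_eq_iff)
  finally show ?thesis .
qed

text \<open>
  On a pair \<open>{a, b}\<close> this is the form \<open>x\<^sub>a\<^sup>2 + x\<^sub>b\<^sup>2 + 2(k - 1) x\<^sub>a x\<^sub>b\<close>. Writing it with sums over the set
  makes it a function of unordered pairs, without choosing an order of the two points.
\<close>

definition pair_form :: "nat \<Rightarrow> ('a \<Rightarrow> nat) \<Rightarrow> 'a set \<Rightarrow> int" where
  "pair_form k x e = (int k - 1) * (\<Sum>a\<in>e. int (x a))\<^sup>2 - (int k - 2) * (\<Sum>a\<in>e. (int (x a))\<^sup>2)"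

lemma pair_form_doubleton:
  "a \<noteq> b \<Longrightarrow> pair_form k x {a, b} =
     (int (x a))\<^sup>2 + (int (x b))\<^sup>2 + 2 * (int k - 1) * int (x a) * int (x b)"
  by (simp add: pair_form_def power2_eq_square algebra_simps)

lemma pair_form_image:
  "inj_on x e \<Longrightarrow> pair_form k id (x ` e) = pair_form k x e"
  by (simp add: pair_form_def sum.reindex)

text \<open>
  The coefficient \<open>2(k - 1)\<close> of the mixed term is chosen for this identity: each point lies in \<open>k - 1\<close>
  pairs, so that the square terms complete the square and the total form has rank one.
\<close>

lemma sum_pair_form:
  assumes "finite V"
  shows "(\<Sum>e\<in>nsets V 2. pair_form (card V) x e) = (int (card V) - 1) * (\<Sum>a\<in>V. int (x a))\<^sup>2"
proof -
  define k where "k = int (card V)"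
  define X where "X = (\<lambda>a. int (x a))"
  define S where "S = sum X V"
  define T where "T = (\<Sum>a\<in>V. (X a)\<^sup>2)"
  have inner: "(\<Sum>b\<in>V - {a}. pair_form (card V) x {a, b})
      = (k - 2) * (X a)\<^sup>2 + T + 2 * (k - 1) * (X a * S - (X a)\<^sup>2)" if a: "a \<in> V" for a
  proof -
    have c: "int (card (V - {a})) = k - 1"
      using a assms card_gt_0_iff[of V] by (auto simp: k_def of_nat_diff)
    have "(\<Sum>b\<in>V - {a}. pair_form (card V) x {a, b})
        = (\<Sum>b\<in>V - {a}. (X a)\<^sup>2 + (X b)\<^sup>2 + 2 * (k - 1) * X a * X b)"
      by (intro sum.cong refl) (auto simp: pair_form_doubleton X_def k_def)
    also have "\<dots> = (k - 1) * (X a)\<^sup>2 + (\<Sum>b\<in>V - {a}. (X b)\<^sup>2) + 2 * (k - 1) * X a * (\<Sum>b\<in>V - {a}. X b)"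
      by (simp add: sum.distrib c flip: sum_distrib_left)
    also have "(\<Sum>b\<in>V - {a}. (X b)\<^sup>2) = T - (X a)\<^sup>2"
      using a assms by (simp add: T_def sum_diff1)
    also have "(\<Sum>b\<in>V - {a}. X b) = S - X a"
      using a assms by (simp add: S_def sum_diff1)
    finally show ?thesis by (simp add: algebra_simps power2_eq_square)
  qed
  have "2 * (\<Sum>e\<in>nsets V 2. pair_form (card V) x e) = (\<Sum>a\<in>V. \<Sum>b\<in>V - {a}. pair_form (card V) x {a, b})"
    by (rule sum_ordered_pairs[OF assms, symmetric])
  also have "\<dots> = (\<Sum>a\<in>V. (k - 2) * (X a)\<^sup>2 + T + 2 * (k - 1) * (X a * S - (X a)\<^sup>2))"
    by (intro sum.cong refl inner)
  also have "\<dots> = (k - 2) * T + k * T + 2 * (k - 1) * (S * S - T)"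
    by (simp add: sum.distrib sum_subtractf k_def T_def S_def sum_distrib_right flip: sum_distrib_left)
  also have "\<dots> = 2 * ((k - 1) * S\<^sup>2)"
    by (simp add: algebra_simps power2_eq_square)
  finally show ?thesis by (simp add: k_def S_def X_def)
qed

text \<open>
  The dependence on the values \<open>u, v\<close> at two points \<open>i, j\<close>, in the shape of the quadratic exponential
  sums in two variables, when the values at all other points are held fixed.
\<close>

lemma pair_form_upd2:
  fixes x :: "'a \<Rightarrow> nat"
  assumes "finite e" "i \<noteq> j"
  defines "s \<equiv> \<Sum>a\<in>e - {i, j}. int (x a)" and "t \<equiv> \<Sum>a\<in>e - {i, j}. (int (x a))\<^sup>2"
  shows "pair_form k (x(i := u, j := v)) e =
     of_bool (i \<in> e) * (int u)\<^sup>2 + of_bool (j \<in> e) * (int v)\<^sup>2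
     + 2 * ((int k - 1) * of_bool (e \<supseteq> {i, j})) * int u * int v
     + 2 * (int k - 1) * s * of_bool (i \<in> e) * int u
     + 2 * (int k - 1) * s * of_bool (j \<in> e) * int v + ((int k - 1) * s\<^sup>2 - (int k - 2) * t)"
proof -
  have split: "sum f e = of_bool (i \<in> e) * f i + of_bool (j \<in> e) * f j + sum f (e - {i, j})" for f :: "'a \<Rightarrow> int"
  proof -
    have "sum f e = of_bool (i \<in> e) * f i + sum f (e - {i})"
      using assms(1) by (simp add: sum.remove)
    also have "sum f (e - {i}) = of_bool (j \<in> e) * f j + sum f (e - {i} - {j})"
      using assms(1,2) by (cases "j \<in> e") (auto simp: sum.remove)
    finally show ?thesis by (simp add: Diff_insert2 [symmetric] insert_commute)
  qed
  have s: "(\<Sum>a\<in>e - {i, j}. int ((x(i := u, j := v)) a)) = s"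
    unfolding s_def by (intro sum.cong) auto
  have t: "(\<Sum>a\<in>e - {i, j}. (int ((x(i := u, j := v)) a))\<^sup>2) = t"
    unfolding t_def by (intro sum.cong) auto
  show ?thesis
    unfolding pair_form_def split s t using assms(2)
    by (cases "i \<in> e"; cases "j \<in> e") (simp_all add: power2_eq_square algebra_simps)
qed

text \<open>
  The form \<open>\<Sum>\<sigma>(e) pair_form e\<close> has diagonal coefficients \<open>d(i)\<close> and off-diagonal ones
  \<open>(card V - 1) \<sigma>{i, j}\<close>. If all its 2 by 2 principal minors vanish and \<open>\<sigma>{i, j} \<noteq> 0\<close>, then
  \<open>d(i) d(j) = (card V - 1)\<^sup>2\<close>. But \<open>d(i)\<close> is a sum of \<open>card V - 1\<close> numbers of modulus at most one, so
  all pairs at \<open>i\<close> carry the same sign, hence so do all pairs at every other point. The bound on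
  the minor ensures that a large prime does not divide it.
\<close>

lemma nonsingular_minor_exists:
  fixes \<sigma> :: "'a set \<Rightarrow> int"
  assumes "finite V" and \<sigma>: "\<sigma> ` nsets V 2 \<subseteq> {-1, 0, 1}"
    and nonconst: "\<not> (\<exists>s. \<forall>e\<in>nsets V 2. \<sigma> e = s)"
  defines "d \<equiv> \<lambda>i. \<Sum>b\<in>V - {i}. \<sigma> {i, b}"
  obtains i j where "i \<in> V" "j \<in> V" "i \<noteq> j"
    "d i * d j - ((int (card V) - 1) * \<sigma> {i, j})\<^sup>2 \<noteq> 0"
    "\<bar>d i * d j - ((int (card V) - 1) * \<sigma> {i, j})\<^sup>2\<bar> \<le> 2 * (int (card V) - 1)\<^sup>2"
proof -
  define m where "m = int (card V) - 1"
  have val: "\<sigma> {a, b} \<in> {-1, 0, 1}" if "a \<in> V" "b \<in> V" "a \<noteq> b" for a b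
    using \<sigma> that by (auto simp: image_subset_iff)
  have card: "int (card (V - {i})) = m" if "i \<in> V" for i
    using that assms(1) card_gt_0_iff[of V] by (auto simp: m_def of_nat_diff)
  have d_le: "\<bar>d i\<bar> \<le> m" if "i \<in> V" for i
  proof -
    have "\<bar>d i\<bar> \<le> (\<Sum>b\<in>V - {i}. \<bar>\<sigma> {i, b}\<bar>)" unfolding d_def by (rule sum_abs)
    also have "\<dots> \<le> (\<Sum>b\<in>V - {i}. 1)"
      by (intro sum_mono) (use val[OF that] in fastforce)
    also have "\<dots> = m" using card[OF that] by simp
    finally show ?thesis .
  qed
  \<comment> \<open>A sum of \<open>m\<close> numbers from \<open>[-1, 1]\<close> equal to \<open>\<plusminus>m\<close> has all summands equal to \<open>\<plusminus>1\<close>.\<close>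
  have extremal: "\<sigma> {i, b} = s" if i: "i \<in> V" and b: "b \<in> V" "b \<noteq> i" and s: "s = 1 \<or> s = -1" "d i = s * m" for i b s
  proof -
    have nonneg: "0 \<le> 1 - s * \<sigma> {i, b}" if "b \<in> V - {i}" for b
      using val[OF i, of b] that s(1) by auto
    have "(\<Sum>b\<in>V - {i}. 1 - s * \<sigma> {i, b}) = m - s * d i"
      using card[OF i] by (simp add: sum_subtractf d_def sum_distrib_left)
    also have "\<dots> = 0" using s by auto
    finally have "1 - s * \<sigma> {i, b} = 0"
      using sum_nonneg_eq_0_iff[of "V - {i}" "\<lambda>b. 1 - s * \<sigma> {i, b}"] nonneg assms(1) b by auto
    then show ?thesis using s(1) by auto
  qed
  have "\<exists>i\<in>V. \<exists>j\<in>V. i \<noteq> j \<and> d i * d j \<noteq> (m * \<sigma> {i, j})\<^sup>2"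
  proof (rule ccontr)
    assume "\<not> ?thesis"
    then have all: "d i * d j = (m * \<sigma> {i, j})\<^sup>2" if "i \<in> V" "j \<in> V" "i \<noteq> j" for i j
      using that by blast
    obtain e where "e \<in> nsets V 2" "\<sigma> e \<noteq> 0" using nonconst by auto
    then obtain i j where ij: "i \<in> V" "j \<in> V" "i \<noteq> j" "\<sigma> {i, j} \<noteq> 0"
      by (auto simp: nsets_2_eq)
    have m: "m > 0"
      using card[OF ij(1)] ij assms(1) card_gt_0_iff[of "V - {i}"] by auto
    have full: "\<exists>s. (s = 1 \<or> s = -1) \<and> d a = s * m" if "a \<in> V" "b \<in> V" "a \<noteq> b" "\<sigma> {a, b} \<noteq> 0" for a b
    proof -
      have "(\<sigma> {a, b})\<^sup>2 = 1" using val[OF that(1-3)] that(4) by auto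
      then have "d a * d b = m\<^sup>2" using all[OF that(1-3)] by (simp add: power_mult_distrib)
      then have eq: "\<bar>d a\<bar> * \<bar>d b\<bar> = m * m" by (metis abs_mult abs_power2 power2_abs power2_eq_square)
      have "\<bar>d a\<bar> = m"
      proof (rule ccontr)
        assume "\<bar>d a\<bar> \<noteq> m"
        then have "\<bar>d a\<bar> < m" using d_le[OF that(1)] by simp
        then have "\<bar>d a\<bar> * m < m * m" using m by simp
        moreover have "\<bar>d a\<bar> * \<bar>d b\<bar> \<le> \<bar>d a\<bar> * m"
          using d_le[OF that(2)] by (intro mult_left_mono) auto
        ultimately have "\<bar>d a\<bar> * \<bar>d b\<bar> < m * m" by simp
        then show False using eq by simp
      qed
      then show ?thesis by (cases "d a \<ge> 0") (auto intro: exI[of _ 1] exI[of _ "-1"])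
    qed
    obtain s where s: "s = 1 \<or> s = -1" "d i = s * m" using full ij by blast
    have row: "\<sigma> {i, b} = s" if "b \<in> V" "b \<noteq> i" for b
      using extremal[OF ij(1) that s] .
    have "\<sigma> {a, b} = s" if ab: "a \<in> V" "b \<in> V" "a \<noteq> b" for a b
    proof (cases "a = i")
      case True
      then show ?thesis using row ab by auto
    next
      case False
      have ai: "\<sigma> {a, i} = s" using row[OF ab(1) False] by (simp add: insert_commute)
      then have "\<sigma> {a, i} \<noteq> 0" using s(1) by auto
      then obtain s' where s': "s' = 1 \<or> s' = -1" "d a = s' * m"
        using full[OF ab(1) ij(1) False] by blast
      have "\<sigma> {a, i} = s'" using extremal[OF ab(1) ij(1) _ s'] False by auto
      then show ?thesis using extremal[OF ab(1,2) _ s'] ab(3) ai by auto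
    qed
    then have "\<forall>e\<in>nsets V 2. \<sigma> e = s" by (auto simp: nsets_2_eq)
    then show False using nonconst by blast
  qed
  then obtain i j where ij: "i \<in> V" "j \<in> V" "i \<noteq> j" "d i * d j \<noteq> (m * \<sigma> {i, j})\<^sup>2" by blast
  have "\<bar>d i * d j - (m * \<sigma> {i, j})\<^sup>2\<bar> \<le> \<bar>d i\<bar> * \<bar>d j\<bar> + m\<^sup>2 * (\<sigma> {i, j})\<^sup>2"
    by (metis abs_mult abs_power2 abs_triangle_ineq4 power_mult_distrib)
  also have "\<dots> \<le> m * m + m\<^sup>2 * 1"
    using d_le[OF ij(1)] d_le[OF ij(2)] val[OF ij(1-3)]
    by (intro add_mono mult_mono) auto
  finally show ?thesis
    using ij by (intro that[of i j]) (auto simp: m_def power2_eq_square)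
qed

lemma sum_PiE_insert:
  assumes "i \<notin> S"
  shows "(\<Sum>x\<in>PiE (insert i S) B. g x) = (\<Sum>x\<in>PiE S B. \<Sum>u\<in>B i. g (x(i := u)) :: 'b :: comm_monoid_add)"
proof -
  have "(\<Sum>x\<in>PiE (insert i S) B. g x) = (\<Sum>(u, x)\<in>B i \<times> PiE S B. g (x(i := u)))"
    unfolding PiE_insert_eq using inj_combinator[OF assms, of B]
    by (subst sum.reindex) (auto simp: case_prod_unfold)
  then show ?thesis by (subst sum.swap) (simp add: sum.cartesian_product)
qed

section \<open>Averages of products over all pairs\<close>

text \<open>
  All points except the two of a nonsingular minor are held fixed; the remaining sum over two
  variables saves a factor \<open>r\<close>.
\<close>

lemma norm_sum_unit_char_nonconstant:
  fixes \<sigma> :: "'a set \<Rightarrow> int"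
  assumes "finite V" "prime r" "odd r" and r: "int r > 2 * (int (card V) - 1)\<^sup>2"
    and \<sigma>: "\<sigma> ` nsets V 2 \<subseteq> {-1, 0, 1}" "\<not> (\<exists>s. \<forall>e\<in>nsets V 2. \<sigma> e = s)"
  shows "norm (\<Sum>x\<in>V \<rightarrow>\<^sub>E {..<n * r}. unit_char r (\<Sum>e\<in>nsets V 2. \<sigma> e * pair_form (card V) x e))
    \<le> real (n * r) ^ card V / real r"
proof -
  define k where "k = card V"
  define d where "d = (\<lambda>i. \<Sum>b\<in>V - {i}. \<sigma> {i, b})"
  from nonsingular_minor_exists[OF assms(1) \<sigma>] obtain i j where ij: "i \<in> V" "j \<in> V" "i \<noteq> j"
    and nz: "d i * d j - ((int k - 1) * \<sigma> {i, j})\<^sup>2 \<noteq> 0"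
    and le: "\<bar>d i * d j - ((int k - 1) * \<sigma> {i, j})\<^sup>2\<bar> \<le> 2 * (int k - 1)\<^sup>2"
    unfolding d_def k_def by metis
  have ndvd: "\<not> int r dvd d i * d j - ((int k - 1) * \<sigma> {i, j})\<^sup>2"
    using dvd_imp_le_int[OF nz] le r unfolding k_def by force
  define S where "S = V - {i, j}"
  have V: "V = insert j (insert i S)" "j \<notin> insert i S" "i \<notin> S" using ij by (auto simp: S_def)
  have fin: "finite (nsets V 2)" using assms(1) by (rule finite_imp_finite_nsets)
  have fin_e: "finite e" if "e \<in> nsets V 2" for e using that by (simp add: nsets_def)
  have "finite S" using assms(1) by (simp add: S_def)
  moreover have "k = card (insert j (insert i S))" unfolding k_def using V(1) by (rule arg_cong)
  ultimately have S: "finite S" "k = card S + 2" using V(2,3) by auto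
  define f where "f = (\<lambda>x. unit_char r (\<Sum>e\<in>nsets V 2. \<sigma> e * pair_form k x e))"
  have inner: "norm (\<Sum>u<n * r. \<Sum>v<n * r. f (x(i := u, j := v))) = real n ^ 2 * real r" for x
  proof -
    define s where "s = (\<lambda>e. \<Sum>a\<in>e - {i, j}. int (x a))"
    define t where "t = (\<lambda>e. \<Sum>a\<in>e - {i, j}. (int (x a))\<^sup>2)"
    define l where "l = (\<lambda>i. \<Sum>e\<in>nsets V 2. \<sigma> e * (2 * (int k - 1) * s e * of_bool (i \<in> e)))"
    define c0 where "c0 = (\<Sum>e\<in>nsets V 2. \<sigma> e * ((int k - 1) * (s e)\<^sup>2 - (int k - 2) * t e))"
    have di: "(\<Sum>e\<in>nsets V 2. \<sigma> e * of_bool (i \<in> e)) = d i" if "i \<in> V" for i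
    proof -
      have "(\<Sum>e\<in>nsets V 2. \<sigma> e * of_bool (i \<in> e)) = (\<Sum>e\<in>nsets V 2. if i \<in> e then \<sigma> e else 0)"
        by (intro sum.cong) auto
      then show ?thesis using sum_pairs_containing[OF assms(1) that, of \<sigma>] by (simp add: d_def)
    qed
    have dij: "(\<Sum>e\<in>nsets V 2. \<sigma> e * of_bool (e \<supseteq> {i, j})) = \<sigma> {i, j}"
    proof -
      have "(e \<supseteq> {i, j}) = (e = {i, j})" if "e \<in> nsets V 2" for e
        using that ij(3) by (auto simp: nsets_2_eq)
      then have "(\<Sum>e\<in>nsets V 2. \<sigma> e * of_bool (e \<supseteq> {i, j})) = (\<Sum>e\<in>nsets V 2. if e = {i, j} then \<sigma> e else 0)"
        by (intro sum.cong) auto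
      also have "\<dots> = \<sigma> {i, j}" using fin ij by (simp add: sum.delta)
      finally show ?thesis .
    qed
    have form: "(\<Sum>e\<in>nsets V 2. \<sigma> e * pair_form k (x(i := u, j := v)) e) =
        d i * (int u)\<^sup>2 + d j * (int v)\<^sup>2 + 2 * ((int k - 1) * \<sigma> {i, j}) * int u * int v
        + l i * int u + l j * int v + c0" for u v
    proof -
      have "(\<Sum>e\<in>nsets V 2. \<sigma> e * pair_form k (x(i := u, j := v)) e) =
         (\<Sum>e\<in>nsets V 2. (\<sigma> e * of_bool (i \<in> e)) * (int u)\<^sup>2 + (\<sigma> e * of_bool (j \<in> e)) * (int v)\<^sup>2
         + (\<sigma> e * of_bool (e \<supseteq> {i, j})) * (2 * (int k - 1) * int u * int v)
         + (\<sigma> e * (2 * (int k - 1) * s e * of_bool (i \<in> e))) * int u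
         + (\<sigma> e * (2 * (int k - 1) * s e * of_bool (j \<in> e))) * int v
         + \<sigma> e * ((int k - 1) * (s e)\<^sup>2 - (int k - 2) * t e))"
        by (intro sum.cong refl) (simp add: pair_form_upd2[OF fin_e ij(3)] s_def t_def algebra_simps)
      also have "\<dots> = d i * (int u)\<^sup>2 + d j * (int v)\<^sup>2 + \<sigma> {i, j} * (2 * (int k - 1) * int u * int v)
        + l i * int u + l j * int v + c0"
        unfolding sum.distrib sum_distrib_right[symmetric] di[OF ij(1)] di[OF ij(2)] dij l_def c0_def ..
      finally show ?thesis by (simp add: algebra_simps)
    qed
    show ?thesis
      unfolding f_def form by (rule norm_sum_unit_char_quadratic_2_blocks[OF assms(2,3) ndvd])
  qed
  have "(\<Sum>x\<in>V \<rightarrow>\<^sub>E {..<n * r}. f x) = (\<Sum>x\<in>S \<rightarrow>\<^sub>E {..<n * r}. \<Sum>u<n * r. \<Sum>v<n * r. f (x(i := u, j := v)))"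
    unfolding V(1) sum_PiE_insert[OF V(2)] sum_PiE_insert[OF V(3)] ..
  also have "norm \<dots> \<le> (\<Sum>x\<in>S \<rightarrow>\<^sub>E {..<n * r}. real n ^ 2 * real r)"
    by (rule sum_norm_le) (simp add: inner)
  also have "\<dots> = real (n * r) ^ card S * (real n ^ 2 * real r)"
    using S(1) by (simp add: card_funcsetE)
  also have "\<dots> = real (n * r) ^ k / real r"
    using prime_gt_0_nat[OF assms(2)] by (simp add: S(2) power2_eq_square field_simps)
  finally show ?thesis by (simp add: f_def k_def)
qed

lemma sum_unit_char_square_of_sum:
  assumes "finite V" "V \<noteq> {}" "r > 0"
  shows "(\<Sum>x\<in>V \<rightarrow>\<^sub>E {..<n * r}. unit_char r (c * (\<Sum>a\<in>V. int (x a))\<^sup>2))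
     = of_nat (n * r) ^ card V * ((\<Sum>u<r. unit_char r (c * (int u)\<^sup>2)) / of_nat r)"
proof -
  define G where "G = (\<Sum>u<r. unit_char r (c * (int u)\<^sup>2))"
  have per: "unit_char r (c * (u + s)\<^sup>2) = unit_char r (c * (v + s)\<^sup>2)" if "int r dvd u - v" for u v s
  proof (rule unit_char_periodic[OF assms(3)])
    have "c * (u + s)\<^sup>2 - c * (v + s)\<^sup>2 = c * ((u - v) * (u + v + 2 * s))"
      by (simp add: power2_eq_square algebra_simps)
    then show "int r dvd c * (u + s)\<^sup>2 - c * (v + s)\<^sup>2" using that by simp
  qed
  have inner: "(\<Sum>u<n * r. unit_char r (c * (int u + s)\<^sup>2)) = of_nat n * G" for s
  proof -
    have "(\<Sum>u<n * r. unit_char r (c * (int u + s)\<^sup>2)) = of_nat n * (\<Sum>u<r. unit_char r (c * (int u + s)\<^sup>2))"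
      by (rule sum_periodic_blocks) (rule per)
    also have "(\<Sum>u<r. unit_char r (c * (int u + s)\<^sup>2)) = G"
      unfolding G_def using per[of _ _ 0] assms(3)
      by (intro sum_periodic_shift[of r "\<lambda>u. unit_char r (c * u\<^sup>2)"]) auto
    finally show ?thesis .
  qed
  obtain i where i: "i \<in> V" using assms(2) by blast
  define S where "S = V - {i}"
  have S: "V = insert i S" "i \<notin> S" "finite S" using i assms(1) by (auto simp: S_def)
  have "(\<Sum>x\<in>V \<rightarrow>\<^sub>E {..<n * r}. unit_char r (c * (\<Sum>a\<in>V. int (x a))\<^sup>2))
      = (\<Sum>x\<in>S \<rightarrow>\<^sub>E {..<n * r}. \<Sum>u<n * r. unit_char r (c * (int u + (\<Sum>a\<in>S. int (x a)))\<^sup>2))"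
    unfolding S(1) sum_PiE_insert[OF S(2)]
  proof (intro sum.cong refl)
    fix x u
    have "(\<Sum>a\<in>insert i S. int ((x(i := u)) a)) = int u + (\<Sum>a\<in>S. int (x a))"
      using S(2,3) by (auto intro!: sum.cong)
    then show "unit_char r (c * (\<Sum>a\<in>insert i S. int ((x(i := u)) a))\<^sup>2) =
        unit_char r (c * (int u + (\<Sum>a\<in>S. int (x a)))\<^sup>2)" by simp
  qed
  also have "\<dots> = of_nat (n * r) ^ card S * (of_nat n * G)"
    using S(3) by (simp add: inner card_funcsetE)
  also have "\<dots> = of_nat (n * r) ^ card V * (G / of_nat r)"
    using S assms(3) by (simp add: field_simps)
  finally show ?thesis by (simp only: G_def)
qed

text \<open>
  Each factor is a sum of three terms, with phase \<open>\<sigma>(e) pair_form e\<close> for \<open>\<sigma>(e) \<in> {-1, 0, 1}\<close>. The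
  constant choices give \<open>\<Prod>A\<close> and a Gauss sum together with its conjugate, which the assumption on
  \<open>\<omega>\<close> makes real and positive. The at most \<open>3 ^ card (nsets V 2)\<close> others are errors of relative
  size \<open>1/r\<close>.
\<close>

lemma sum_prod_pairs_lower_bound:
  fixes A B :: "'a set \<Rightarrow> real" and \<omega> :: complex
  assumes "finite V" "card V \<ge> 2" "prime r" "odd r" and r: "int r > 2 * (int (card V) - 1)\<^sup>2"
    and A: "\<And>e. e \<in> nsets V 2 \<Longrightarrow> \<bar>A e\<bar> \<le> 1" and B: "\<And>e. e \<in> nsets V 2 \<Longrightarrow> \<bar>B e\<bar> \<le> 1"
    and \<omega>: "norm \<omega> = 1"
    and phase: "of_real (\<Prod>e\<in>nsets V 2. B e) * \<omega> ^ card (nsets V 2) *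
        (\<Sum>u<r. unit_char r ((int (card V) - 1) * (int u)\<^sup>2)) = of_real (\<bar>\<Prod>e\<in>nsets V 2. B e\<bar> * sqrt (real r))"
  shows "(\<Sum>x\<in>V \<rightarrow>\<^sub>E {..<n * r}. \<Prod>e\<in>nsets V 2. A e + B e * (2 * Re (\<omega> * unit_char r (pair_form (card V) x e))))
    \<ge> real (n * r) ^ card V * ((\<Prod>e\<in>nsets V 2. A e) + 2 * \<bar>\<Prod>e\<in>nsets V 2. B e\<bar> / sqrt (real r)
         - 3 ^ card (nsets V 2) / real r)"
proof -
  define P where "P = nsets V 2"
  define k where "k = card V"
  define N where "N = real (n * r) ^ k"
  have r0: "r > 0" using assms(3) by (simp add: prime_gt_0_nat)
  have finP: "finite P" unfolding P_def using assms(1) by (rule finite_imp_finite_nsets)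
  have Pne: "P \<noteq> {}"
    using assms(1,2) unfolding P_def by (simp add: nsets_eq_empty_iff)
  define X where "X = (V \<rightarrow>\<^sub>E {..<n * r})"
  define \<Sigma> where "\<Sigma> = (P \<rightarrow>\<^sub>E {-1, 0, 1 :: int})"
  have fin\<Sigma>: "finite \<Sigma>" unfolding \<Sigma>_def using finP by (intro finite_PiE) auto
  define coef where "coef = (\<lambda>e (s::int). if s = 0 then of_real (A e) else
     if s = 1 then of_real (B e) * \<omega> else of_real (B e) * cnj \<omega>)"
  define T where "T = (\<lambda>\<sigma>. \<Sum>x\<in>X. unit_char r (\<Sum>e\<in>P. \<sigma> e * pair_form k x e))"
  define cs where "cs = (\<lambda>s::int. restrict (\<lambda>_. s) P)"
  define trm where "trm = (\<lambda>\<sigma>. (\<Prod>e\<in>P. coef e (\<sigma> e)) * T \<sigma>)"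
  define lhs where "lhs = (\<Sum>x\<in>X. \<Prod>e\<in>P. A e + B e * (2 * Re (\<omega> * unit_char r (pair_form k x e))))"
  have "of_real lhs = (\<Sum>x\<in>X. \<Prod>e\<in>P. \<Sum>s\<in>{-1, 0, 1}. coef e s * unit_char r (s * pair_form k x e))"
    unfolding lhs_def of_real_sum of_real_prod
  proof (intro sum.cong prod.cong refl)
    fix x :: "'a \<Rightarrow> nat" and e :: "'a set"
    let ?w = "\<omega> * unit_char r (pair_form k x e)"
    have "complex_of_real (A e + B e * (2 * Re ?w)) = of_real (A e) + of_real (B e) * (?w + cnj ?w)"
      by (simp only: complex_add_cnj of_real_add of_real_mult)
    then show "complex_of_real (A e + B e * (2 * Re ?w)) =
        (\<Sum>s\<in>{-1, 0, 1}. coef e s * unit_char r (s * pair_form k x e))"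
      by (simp add: coef_def unit_char_uminus algebra_simps)
  qed
  also have "\<dots> = (\<Sum>x\<in>X. \<Sum>\<sigma>\<in>\<Sigma>. \<Prod>e\<in>P. coef e (\<sigma> e) * unit_char r (\<sigma> e * pair_form k x e))"
    unfolding \<Sigma>_def using finP by (intro sum.cong refl prod_sum_PiE) auto
  also have "\<dots> = (\<Sum>x\<in>X. \<Sum>\<sigma>\<in>\<Sigma>. (\<Prod>e\<in>P. coef e (\<sigma> e)) * unit_char r (\<Sum>e\<in>P. \<sigma> e * pair_form k x e))"
    by (simp only: prod.distrib unit_char_sum)
  also have "\<dots> = (\<Sum>\<sigma>\<in>\<Sigma>. \<Sum>x\<in>X. (\<Prod>e\<in>P. coef e (\<sigma> e)) * unit_char r (\<Sum>e\<in>P. \<sigma> e * pair_form k x e))"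
    by (rule sum.swap)
  also have "\<dots> = (\<Sum>\<sigma>\<in>\<Sigma>. trm \<sigma>)"
    by (simp only: trm_def T_def sum_distrib_left)
  finally have lhs: "of_real lhs = (\<Sum>\<sigma>\<in>\<Sigma>. trm \<sigma>)" .
  define C where "C = {cs (-1), cs 0, cs 1}"
  have cs_neq: "cs s \<noteq> cs t" if "s \<noteq> t" for s t
    using Pne that unfolding cs_def by (metis ex_in_conv restrict_apply')
  have C: "C \<subseteq> \<Sigma>" unfolding C_def \<Sigma>_def cs_def by auto
  have sumC: "(\<Sum>\<sigma>\<in>C. trm \<sigma>) = trm (cs 0) + (trm (cs 1) + trm (cs (-1)))"
    unfolding C_def using cs_neq[of "-1" 0] cs_neq[of "-1" 1] cs_neq[of 0 1] by (simp add: add_ac)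
  have cardX: "card X = (n * r) ^ k" unfolding X_def k_def using assms(1) by (simp add: card_funcsetE)
  have t0: "trm (cs 0) = of_real (N * (\<Prod>e\<in>P. A e))"
    unfolding trm_def T_def by (simp add: cs_def coef_def cardX N_def)
  define G where "G = (\<Sum>u<r. unit_char r ((int k - 1) * (int u)\<^sup>2))"
  have V: "V \<noteq> {}" using assms(2) by auto
  have Tcs: "T (cs s) = (\<Sum>x\<in>X. unit_char r (s * ((int k - 1) * (\<Sum>a\<in>V. int (x a))\<^sup>2)))" for s
  proof -
    have "(\<Sum>e\<in>P. cs s e * pair_form k x e) = s * ((int k - 1) * (\<Sum>a\<in>V. int (x a))\<^sup>2)" for x
    proof -
      have "(\<Sum>e\<in>P. cs s e * pair_form k x e) = s * (\<Sum>e\<in>P. pair_form k x e)"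
        by (simp add: cs_def sum_distrib_left)
      then show ?thesis unfolding P_def k_def by (simp only: sum_pair_form[OF assms(1)])
    qed
    then show ?thesis by (simp add: T_def)
  qed
  have T1: "T (cs 1) = of_real N * (G / of_nat r)"
    unfolding Tcs using sum_unit_char_square_of_sum[OF assms(1) V r0, where n = n and c = "int k - 1"]
    by (simp add: X_def G_def N_def k_def)
  have Tm1: "T (cs (-1)) = cnj (T (cs 1))"
    unfolding Tcs by (simp add: unit_char_uminus)
  have t1: "trm (cs 1) = of_real (N * (\<bar>\<Prod>e\<in>P. B e\<bar> / sqrt (real r)))"
  proof -
    have "(\<Prod>e\<in>P. coef e (cs 1 e)) = of_real (\<Prod>e\<in>P. B e) * \<omega> ^ card P"
      by (simp add: cs_def coef_def prod.distrib)
    then have "trm (cs 1) = of_real (\<Prod>e\<in>P. B e) * \<omega> ^ card P * (of_real N * (G / of_nat r))"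
      by (simp only: trm_def T1)
    also have "\<dots> = of_real N * ((of_real (\<Prod>e\<in>P. B e) * \<omega> ^ card P * G) / of_nat r)"
      by (simp add: mult_ac)
    also have "of_real (\<Prod>e\<in>P. B e) * \<omega> ^ card P * G = of_real (\<bar>\<Prod>e\<in>P. B e\<bar> * sqrt (real r))"
      using phase unfolding P_def G_def k_def .
    also have "\<dots> / of_nat r = of_real (\<bar>\<Prod>e\<in>P. B e\<bar> * sqrt (real r) / real r)" by simp
    also have "\<bar>\<Prod>e\<in>P. B e\<bar> * sqrt (real r) / real r = \<bar>\<Prod>e\<in>P. B e\<bar> / sqrt (real r)"
      using r0 by (simp add: field_simps flip: real_sqrt_mult)
    finally show ?thesis by simp
  qed
  have tm1: "trm (cs (-1)) = cnj (trm (cs 1))"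
  proof -
    have "(\<Prod>e\<in>P. coef e (cs (-1) e)) = cnj (\<Prod>e\<in>P. coef e (cs 1 e))"
      by (simp add: cs_def coef_def)
    then show ?thesis by (simp only: trm_def Tm1 complex_cnj_mult)
  qed
  have rest: "norm (\<Sum>\<sigma>\<in>\<Sigma> - C. trm \<sigma>) \<le> 3 ^ card P * (N / real r)"
  proof -
    have "norm (\<Sum>\<sigma>\<in>\<Sigma> - C. trm \<sigma>) \<le> (\<Sum>\<sigma>\<in>\<Sigma> - C. N / real r)"
    proof (rule sum_norm_le)
      fix \<sigma> assume \<sigma>: "\<sigma> \<in> \<Sigma> - C"
      have "norm (\<Prod>e\<in>P. coef e (\<sigma> e)) = (\<Prod>e\<in>P. norm (coef e (\<sigma> e)))" by (simp add: prod_norm)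
      also have "\<dots> \<le> 1"
        using A B \<omega> by (intro prod_le_1) (auto simp: coef_def norm_mult P_def)
      finally have 1: "norm (\<Prod>e\<in>P. coef e (\<sigma> e)) \<le> 1" .
      have nonconst: "\<not> (\<exists>s. \<forall>e\<in>P. \<sigma> e = s)"
      proof
        assume "\<exists>s. \<forall>e\<in>P. \<sigma> e = s"
        then obtain s where s: "\<forall>e\<in>P. \<sigma> e = s" by blast
        have "\<sigma> = cs s" using \<sigma> s unfolding \<Sigma>_def cs_def
          by (intro ext) (auto simp: PiE_def extensional_def)
        moreover have "s \<in> {-1, 0, 1}" using Pne s \<sigma> unfolding \<Sigma>_def by fastforce
        ultimately show False using \<sigma> unfolding C_def by auto
      qed
      have "norm (T \<sigma>) \<le> N / real r"
        unfolding T_def X_def P_def k_def N_def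
        using \<sigma> nonconst assms(1,3,4) r
        by (intro norm_sum_unit_char_nonconstant) (auto simp: \<Sigma>_def P_def PiE_def)
      then have "norm (\<Prod>e\<in>P. coef e (\<sigma> e)) * norm (T \<sigma>) \<le> 1 * (N / real r)"
        using 1 by (intro mult_mono) auto
      then show "norm (trm \<sigma>) \<le> N / real r" by (simp add: trm_def norm_mult)
    qed
    also have "\<dots> = real (card (\<Sigma> - C)) * (N / real r)" by simp
    also have "\<dots> \<le> real (card \<Sigma>) * (N / real r)"
      using fin\<Sigma> by (intro mult_right_mono) (auto simp: N_def card_mono)
    also have "card \<Sigma> = 3 ^ card P" unfolding \<Sigma>_def using finP by (simp add: card_funcsetE numeral_3_eq_3)
    finally show ?thesis by simp
  qed
  have "of_real lhs = (\<Sum>\<sigma>\<in>C. trm \<sigma>) + (\<Sum>\<sigma>\<in>\<Sigma> - C. trm \<sigma>)"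
    unfolding lhs using sum.subset_diff[OF C fin\<Sigma>] by (simp add: add.commute)
  then have "lhs = Re ((\<Sum>\<sigma>\<in>C. trm \<sigma>) + (\<Sum>\<sigma>\<in>\<Sigma> - C. trm \<sigma>))" by (metis Re_complex_of_real)
  also have "\<dots> = N * (\<Prod>e\<in>P. A e) + 2 * (N * (\<bar>\<Prod>e\<in>P. B e\<bar> / sqrt (real r))) + Re (\<Sum>\<sigma>\<in>\<Sigma> - C. trm \<sigma>)"
    unfolding sumC tm1 t0 t1 by (simp del: of_real_mult of_real_divide)
  finally have "lhs \<ge> N * (\<Prod>e\<in>P. A e) + 2 * (N * (\<bar>\<Prod>e\<in>P. B e\<bar> / sqrt (real r))) - 3 ^ card P * (N / real r)"
    using rest abs_Re_le_cmod[of "\<Sum>\<sigma>\<in>\<Sigma> - C. trm \<sigma>"] by linarith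
  then show ?thesis
    unfolding lhs_def X_def P_def k_def N_def by (simp add: algebra_simps)
qed

section \<open>A tilted kernel with too many copies\<close>

lemma rotate_to_nonneg_real:
  assumes "m > 0"
  obtains \<omega> :: complex where "norm \<omega> = 1" "z * \<omega> ^ m = of_real (norm z)"
proof (cases "z = 0")
  case True
  then show ?thesis by (intro that[of 1]) auto
next
  case False
  show ?thesis
  proof (rule that[of "cis (- Arg z / real m)"])
    have "cis (- Arg z / real m) ^ m = cis (- Arg z)"
      using assms by (simp add: Complex.DeMoivre)
    then have "z * cis (- Arg z / real m) ^ m = rcis (norm z) (Arg z) * cis (- Arg z)"
      by (simp add: rcis_cmod_Arg)
    also have "\<dots> = of_real (norm z)" by (simp add: rcis_def cis_mult)
    finally show "z * cis (- Arg z / real m) ^ m = of_real (norm z)" .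
  qed simp
qed

lemma card_nsets: "finite A \<Longrightarrow> card (nsets A m) = card A choose m"
  unfolding nsets_def using n_subsets[of A m] by (metis (no_types, lifting) Collect_cong finite_subset)

lemma rand_density_eq_prod:
  assumes "finite_simple_graph F"
  shows "rand_density F p = (\<Prod>e\<in>nsets (verts F) 2. if e \<in> edges F then p else 1 - p)"
proof -
  define P where "P = nsets (verts F) 2"
  have fin: "finite (verts F)" and sub: "edges F \<subseteq> P"
    using assms by (auto simp: finite_simple_graph_def P_def)
  then have finP: "finite P" by (simp add: P_def finite_imp_finite_nsets)
  have "(\<Prod>e\<in>P. if e \<in> edges F then p else 1 - p) = p ^ card (P \<inter> edges F) * (1 - p) ^ card (P \<inter> - edges F)"
    using finP by (simp add: prod.If_cases Int_def Compl_eq)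
  also have "P \<inter> edges F = edges F" using sub by auto
  also have "P \<inter> - edges F = P - edges F" by auto
  also have "card (P - edges F) = card P - card (edges F)"
    using sub finP by (intro card_Diff_subset) (auto intro: finite_subset)
  finally show ?thesis using fin by (simp add: rand_density_def P_def card_nsets)
qed

text \<open>
  The kernel is \<open>p - m + 2 \<eta> Re(\<omega> \<chi>)\<close>, where \<open>m\<close> is the mean of its oscillating part. The gain is
  \<open>2 \<eta>\<^sup>c / \<surd>r\<close>, with \<open>c\<close> the number of pairs, against errors \<open>3\<^sup>c / r\<close> from the expansion and at most
  \<open>2c / r\<close> from the shift by \<open>m\<close>. The point of the statement is that the surplus \<open>\<gamma>\<close> does not depend on
  the number of vertices \<open>n * r\<close>.
\<close>

lemma tilted_kernel_exists:
  fixes F :: "'a graph" and p :: real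
  assumes F: "finite_simple_graph F" and k3: "card (verts F) \<ge> 3" and p: "0 < p" "p < 1"
  obtains r :: nat and \<kappa> :: "int \<Rightarrow> real" and \<gamma> :: real
  where "r > 0" "\<gamma> > 0" "\<And>a. 0 \<le> \<kappa> a" "\<And>a. \<kappa> a \<le> 1"
    and "\<And>a b. int r dvd a - b \<Longrightarrow> \<kappa> a = \<kappa> b"
    and "(\<Sum>u<r. \<Sum>v<r. \<kappa> ((int u)\<^sup>2 + (int v)\<^sup>2 + 2 * (int (card (verts F)) - 1) * int u * int v)) = (real r)\<^sup>2 * p"
    and "\<And>n. (\<Sum>x\<in>verts F \<rightarrow>\<^sub>E {..<n * r}. \<Prod>e\<in>nsets (verts F) 2.
           if e \<in> edges F then \<kappa> (pair_form (card (verts F)) x e) else 1 - \<kappa> (pair_form (card (verts F)) x e))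
         \<ge> real (n * r) ^ card (verts F) * (rand_density F p + \<gamma>)"
proof -
  define V where "V = verts F"
  define k where "k = card V"
  define P where "P = nsets V 2"
  define c where "c = card P"
  have finV: "finite V" and EP: "edges F \<subseteq> P" using F by (auto simp: finite_simple_graph_def V_def P_def)
  then have finP: "finite P" by (simp add: P_def finite_imp_finite_nsets)
  have k: "k \<ge> 3" using k3 by (simp add: k_def V_def)
  have "P \<noteq> {}" using k finV by (simp add: P_def k_def nsets_eq_empty_iff)
  then have c: "c > 0" using finP by (simp add: c_def card_gt_0_iff)
  define \<eta> where "\<eta> = min p (1 - p) / 4"
  have \<eta>: "\<eta> > 0" "4 * \<eta> \<le> p" "4 * \<eta> \<le> 1 - p" using p by (auto simp: \<eta>_def)
  then have \<eta>1: "\<eta> \<le> 1" using p by linarith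
  \<comment> \<open>\<open>r > D\<^sup>2\<close> says exactly that the gain exceeds the errors.\<close>
  define D where "D = (3 ^ c + 2 * real c) / (2 * \<eta> ^ c)"
  have Dpos: "D \<ge> 0" using \<eta> by (simp add: D_def)
  obtain r where r: "prime r" "r > max (2 * k\<^sup>2) (nat \<lceil>D\<^sup>2\<rceil>)" using bigger_prime by blast
  have rk: "r > 2 * k\<^sup>2" using r(2) by simp
  have rD: "real r > D\<^sup>2" using r(2) by linarith
  have r0: "r > 0" using r(1) by (simp add: prime_gt_0_nat)
  have r2: "r > 2"
  proof -
    have "2 * 3\<^sup>2 \<le> 2 * k\<^sup>2" using k by (intro mult_left_mono power_mono) auto
    then show ?thesis using rk by simp
  qed
  have odd: "odd r" using r(1) r2 prime_odd_nat by blast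
  have k1: "2 * (int k - 1)\<^sup>2 \<le> 2 * (int k)\<^sup>2" using k by (intro mult_left_mono power_mono) auto
  have rk_int: "int r > 2 * (int k)\<^sup>2" using rk by (metis of_nat_less_iff of_nat_mult of_nat_numeral of_nat_power)
  have rk1: "int r > 2 * (int k - 1)\<^sup>2" using k1 rk_int by linarith

  \<comment> \<open>A non-edge contributes \<open>1 - \<kappa>\<close>, which reverses the sign of the oscillating part.\<close>
  define B where "B = (\<lambda>e. if e \<in> edges F then \<eta> else - \<eta>)"
  have prodB: "\<bar>\<Prod>e\<in>P. B e\<bar> = \<eta> ^ c"
  proof -
    have "\<bar>\<Prod>e\<in>P. B e\<bar> = (\<Prod>e\<in>P. \<bar>B e\<bar>)" by (rule abs_prod)
    also have "\<dots> = (\<Prod>e\<in>P. \<eta>)" using \<eta>(1) by (intro prod.cong) (auto simp: B_def)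
    finally show ?thesis by (simp add: c_def)
  qed
  define G where "G = (\<Sum>u<r. unit_char r ((int k - 1) * (int u)\<^sup>2))"
  have "\<not> int r dvd int k - 1"
  proof
    assume "int r dvd int k - 1"
    then have "int r \<le> int k - 1" using k by (intro zdvd_imp_le) auto
    moreover have "int k \<le> (int k)\<^sup>2" using k by (simp add: power2_eq_square)
    ultimately show False using rk_int by (auto simp: sum_power2_ge_zero)
  qed
  then have normG: "norm G = sqrt (real r)" unfolding G_def by (rule norm_gauss_sum[OF r(1) odd])
  obtain \<omega> :: complex where \<omega>: "norm \<omega> = 1"
    "(of_real (\<Prod>e\<in>P. B e) * G) * \<omega> ^ c = of_real (norm (of_real (\<Prod>e\<in>P. B e) * G))"
    using rotate_to_nonneg_real[OF c] by blast
  have phase: "of_real (\<Prod>e\<in>P. B e) * \<omega> ^ c * G = of_real (\<bar>\<Prod>e\<in>P. B e\<bar> * sqrt (real r))"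
    using \<omega>(2) by (simp only: norm_mult norm_of_real normG) (simp add: mult_ac)

  define form where "form = (\<lambda>u v. u\<^sup>2 + v\<^sup>2 + 2 * (int k - 1) * u * v)"
  \<comment> \<open>The mean over a single pair: its form has determinant \<open>1 - (k - 1)\<^sup>2\<close>, nonzero since \<open>k \<ge> 3\<close>.\<close>
  define m where "m = (\<Sum>u<r. \<Sum>v<r. 2 * \<eta> * Re (\<omega> * unit_char r (form (int u) (int v)))) / (real r)\<^sup>2"
  have m: "\<bar>m\<bar> \<le> 2 * \<eta> / real r"
  proof -
    have ndvd: "\<not> int r dvd 1 * 1 - (int k - 1)\<^sup>2"
    proof
      assume *: "int r dvd 1 * 1 - (int k - 1)\<^sup>2"
      have "(int k - 1)\<^sup>2 \<ge> 2\<^sup>2" using k by (intro power_mono) auto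
      then have "\<bar>1 * 1 - (int k - 1)\<^sup>2\<bar> \<noteq> 0" "\<bar>1 * 1 - (int k - 1)\<^sup>2\<bar> \<le> (int k - 1)\<^sup>2" by auto
      then have "int r \<le> (int k - 1)\<^sup>2" using dvd_imp_le_int[OF _ *] by force
      then show False using rk1 zero_le_power2[of "int k - 1"] by linarith
    qed
    have "norm (\<Sum>u<r. \<Sum>v<r. unit_char r (form (int u) (int v))) = real r"
      using norm_sum_unit_char_quadratic_2[OF r(1) odd ndvd, of 0 0 0] by (simp add: form_def mult.assoc)
    then have "norm (\<omega> * (\<Sum>u<r. \<Sum>v<r. unit_char r (form (int u) (int v)))) = real r"
      using \<omega>(1) by (simp add: norm_mult)
    then have "\<bar>Re (\<omega> * (\<Sum>u<r. \<Sum>v<r. unit_char r (form (int u) (int v))))\<bar> \<le> real r"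
      using abs_Re_le_cmod[of "\<omega> * (\<Sum>u<r. \<Sum>v<r. unit_char r (form (int u) (int v)))"] by simp
    then have 1: "\<bar>\<Sum>u<r. \<Sum>v<r. Re (\<omega> * unit_char r (form (int u) (int v)))\<bar> \<le> real r"
      by (simp only: sum_distrib_left Re_sum)
    have "m = 2 * \<eta> * (\<Sum>u<r. \<Sum>v<r. Re (\<omega> * unit_char r (form (int u) (int v)))) / (real r)\<^sup>2"
      by (simp only: m_def sum_distrib_left)
    then have "\<bar>m\<bar> = 2 * \<eta> * \<bar>\<Sum>u<r. \<Sum>v<r. Re (\<omega> * unit_char r (form (int u) (int v)))\<bar> / (real r)\<^sup>2"
      using \<eta>(1) by (simp add: abs_mult)
    also have "\<dots> \<le> 2 * \<eta> * real r / (real r)\<^sup>2"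
      using 1 \<eta>(1) by (intro divide_right_mono mult_left_mono) auto
    finally show ?thesis using r0 by (simp add: power2_eq_square)
  qed
  have m_\<eta>: "\<bar>m\<bar> \<le> \<eta>"
  proof -
    have "2 * \<eta> / real r \<le> \<eta>" using r2 \<eta>(1) by (simp add: field_simps)
    then show ?thesis using m by linarith
  qed
  define \<kappa> where "\<kappa> = (\<lambda>a. p - m + \<eta> * (2 * Re (\<omega> * unit_char r a)))"
  have osc: "\<bar>\<eta> * (2 * Re (\<omega> * unit_char r a))\<bar> \<le> 2 * \<eta>" for a
    using abs_Re_le_cmod[of "\<omega> * unit_char r a"] \<omega>(1) \<eta>(1) by (simp add: abs_mult norm_mult)
  define A where "A = (\<lambda>e. if e \<in> edges F then p - m else 1 - p + m)"
  define \<gamma> where "\<gamma> = 2 * \<eta> ^ c / sqrt (real r) - (3 ^ c + 2 * real c) / real r"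
  have prodA: "(\<Prod>e\<in>P. A e) \<ge> rand_density F p - 2 * real c / real r"
  proof -
    have "norm ((\<Prod>e\<in>P. A e) - (\<Prod>e\<in>P. if e \<in> edges F then p else 1 - p))
        \<le> (\<Sum>e\<in>P. norm (A e - (if e \<in> edges F then p else 1 - p)))"
      using p m_\<eta> \<eta> by (intro norm_prod_diff) (auto simp: A_def)
    also have "\<dots> \<le> (\<Sum>e\<in>P. 2 / real r)"
    proof (rule sum_mono)
      fix e
      have "2 * \<eta> / real r \<le> 2 / real r" using \<eta>1 by (intro divide_right_mono) auto
      then show "norm (A e - (if e \<in> edges F then p else 1 - p)) \<le> 2 / real r"
        using m by (auto simp: A_def)
    qed
    finally show ?thesis
      unfolding rand_density_eq_prod[OF F] V_def[symmetric] P_def[symmetric] by (simp add: c_def)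
  qed
  show ?thesis
  proof (rule that[of r \<gamma> \<kappa>])
    show "r > 0" by fact
    show "\<gamma> > 0"
    proof -
      have "D < sqrt (real r)" using rD Dpos by (simp add: real_less_rsqrt)
      then have "3 ^ c + 2 * real c < 2 * \<eta> ^ c * sqrt (real r)"
        using \<eta>(1) by (simp add: D_def field_simps)
      then have "(3 ^ c + 2 * real c) / real r < 2 * \<eta> ^ c * sqrt (real r) / real r"
        using r0 by (intro divide_strict_right_mono) auto
      also have "2 * \<eta> ^ c * sqrt (real r) / real r = 2 * \<eta> ^ c / sqrt (real r)"
        using r0 by (simp add: field_simps flip: real_sqrt_mult)
      finally show ?thesis by (simp add: \<gamma>_def)
    qed
    show "0 \<le> \<kappa> a" "\<kappa> a \<le> 1" for a
      using osc[of a] m_\<eta> \<eta> p unfolding \<kappa>_def by linarith+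
    show "\<kappa> a = \<kappa> b" if "int r dvd a - b" for a b
      using unit_char_periodic[OF r0 that] by (simp add: \<kappa>_def)
    show "(\<Sum>u<r. \<Sum>v<r. \<kappa> ((int u)\<^sup>2 + (int v)\<^sup>2 + 2 * (int (card (verts F)) - 1) * int u * int v)) = (real r)\<^sup>2 * p"
    proof -
      have "(\<Sum>u<r. \<Sum>v<r. \<kappa> (form (int u) (int v))) = (real r)\<^sup>2 * (p - m) + (real r)\<^sup>2 * m"
        using r0 by (simp add: \<kappa>_def sum.distrib m_def power2_eq_square mult_ac)
      then show ?thesis by (simp add: form_def k_def V_def algebra_simps)
    qed
    fix n
    have "(\<Sum>x\<in>V \<rightarrow>\<^sub>E {..<n * r}. \<Prod>e\<in>P. if e \<in> edges F then \<kappa> (pair_form k x e) else 1 - \<kappa> (pair_form k x e))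
        = (\<Sum>x\<in>V \<rightarrow>\<^sub>E {..<n * r}. \<Prod>e\<in>P. A e + B e * (2 * Re (\<omega> * unit_char r (pair_form k x e))))"
      by (intro sum.cong prod.cong refl) (auto simp: \<kappa>_def A_def B_def)
    also have "\<dots> \<ge> real (n * r) ^ k * ((\<Prod>e\<in>P. A e) + 2 * \<bar>\<Prod>e\<in>P. B e\<bar> / sqrt (real r) - 3 ^ c / real r)"
      unfolding P_def k_def c_def
    proof (rule sum_prod_pairs_lower_bound[OF finV _ r(1) odd])
      show "card V \<ge> 2" using k by (simp add: k_def)
      show "int r > 2 * (int (card V) - 1)\<^sup>2" using rk1 by (simp add: k_def)
      show "\<bar>A e\<bar> \<le> 1" for e using p m_\<eta> \<eta> by (auto simp: A_def)
      show "\<bar>B e\<bar> \<le> 1" for e using \<eta> \<eta>1 by (auto simp: B_def)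
      show "norm \<omega> = 1" by fact
    qed (use phase in \<open>simp only: P_def c_def G_def k_def\<close>)
    moreover have "real (n * r) ^ k * ((\<Prod>e\<in>P. A e) + 2 * \<bar>\<Prod>e\<in>P. B e\<bar> / sqrt (real r) - 3 ^ c / real r)
        \<ge> real (n * r) ^ k * (rand_density F p + \<gamma>)"
      using prodA unfolding prodB by (intro mult_left_mono) (auto simp: \<gamma>_def add_divide_distrib)
    ultimately show "(\<Sum>x\<in>verts F \<rightarrow>\<^sub>E {..<n * r}. \<Prod>e\<in>nsets (verts F) 2.
           if e \<in> edges F then \<kappa> (pair_form (card (verts F)) x e) else 1 - \<kappa> (pair_form (card (verts F)) x e))
         \<ge> real (n * r) ^ card (verts F) * (rand_density F p + \<gamma>)"
      unfolding V_def P_def k_def by linarith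
  qed
qed

section \<open>Rounding a weighted graph\<close>

text \<open>
  The probability that \<open>S\<close> is the random subset of \<open>Q\<close> containing each \<open>e\<close> independently with
  probability \<open>w e\<close>.
\<close>

definition subset_weight :: "'e set \<Rightarrow> ('e \<Rightarrow> real) \<Rightarrow> 'e set \<Rightarrow> real" where
  "subset_weight Q w S = (\<Prod>e\<in>S. w e) * (\<Prod>e\<in>Q - S. 1 - w e)"

lemma subset_weight_nonneg:
  "S \<subseteq> Q \<Longrightarrow> (\<And>e. e \<in> Q \<Longrightarrow> 0 \<le> w e \<and> w e \<le> 1) \<Longrightarrow> 0 \<le> subset_weight Q w S"
  unfolding subset_weight_def by (intro mult_nonneg_nonneg prod_nonneg) auto

text \<open>
  Expanding \<open>\<Prod>(f e + g e)\<close>, where \<open>f\<close> is \<open>w\<close> set to zero on \<open>D\<close> and \<open>g\<close> is \<open>1 - w\<close> set to zero on \<open>C\<close>,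
  leaves exactly the subsets \<open>S\<close> with \<open>C \<subseteq> S\<close> and \<open>S \<inter> D = {}\<close>.
\<close>

lemma sum_subset_weight_cylinder:
  assumes "finite Q" "C \<subseteq> Q" "D \<subseteq> Q" "C \<inter> D = {}"
  shows "(\<Sum>S\<in>Pow Q. subset_weight Q w S * of_bool (C \<subseteq> S \<and> S \<inter> D = {})) = (\<Prod>e\<in>C. w e) * (\<Prod>e\<in>D. 1 - w e)"
proof -
  define f where "f = (\<lambda>e. if e \<in> D then 0 else w e)"
  define g where "g = (\<lambda>e. if e \<in> C then 0 else 1 - w e)"
  have fin: "finite S" if "S \<subseteq> Q" for S using that assms(1) finite_subset by blast
  have "(\<Sum>S\<in>Pow Q. subset_weight Q w S * of_bool (C \<subseteq> S \<and> S \<inter> D = {}))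
      = (\<Sum>S\<in>Pow Q. (\<Prod>e\<in>S. f e) * (\<Prod>e\<in>Q - S. g e))"
  proof (rule sum.cong[OF refl])
    fix S assume "S \<in> Pow Q"
    then have S: "S \<subseteq> Q" by simp
    show "subset_weight Q w S * of_bool (C \<subseteq> S \<and> S \<inter> D = {}) = (\<Prod>e\<in>S. f e) * (\<Prod>e\<in>Q - S. g e)"
    proof (cases "C \<subseteq> S \<and> S \<inter> D = {}")
      case True
      then have "(\<Prod>e\<in>S. f e) = (\<Prod>e\<in>S. w e)" "(\<Prod>e\<in>Q - S. g e) = (\<Prod>e\<in>Q - S. 1 - w e)"
        by (auto intro!: prod.cong simp: f_def g_def)
      then show ?thesis using True by (simp add: subset_weight_def)
    next
      case False
      then consider e where "e \<in> C" "e \<in> Q - S" | e where "e \<in> S" "e \<in> D" using assms(2) by blast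
      then have "(\<Prod>e\<in>S. f e) * (\<Prod>e\<in>Q - S. g e) = 0"
      proof cases
        case 1
        then have "(\<Prod>e\<in>Q - S. g e) = 0" using assms(1) by (intro prod_zero) (auto simp: g_def)
        then show ?thesis by simp
      next
        case 2
        then have "(\<Prod>e\<in>S. f e) = 0" using fin[OF S] by (intro prod_zero) (auto simp: f_def)
        then show ?thesis by simp
      qed
      moreover have "of_bool (C \<subseteq> S \<and> S \<inter> D = {}) = (0 :: real)"
        using False by (simp only: of_bool_def if_False)
      ultimately show ?thesis by (simp only: mult_zero_right)
    qed
  qed
  also have "\<dots> = (\<Prod>e\<in>Q. f e + g e)" by (rule prod_add[OF assms(1), symmetric])
  also have "\<dots> = (\<Prod>e\<in>C \<union> D. f e + g e)"
    using assms by (intro prod.mono_neutral_right) (auto simp: f_def g_def)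
  also have "\<dots> = (\<Prod>e\<in>C. f e + g e) * (\<Prod>e\<in>D. f e + g e)"
    using assms fin by (intro prod.union_disjoint) auto
  also have "(\<Prod>e\<in>C. f e + g e) = (\<Prod>e\<in>C. w e)"
    using assms(4) by (intro prod.cong) (auto simp: f_def g_def)
  also have "(\<Prod>e\<in>D. f e + g e) = (\<Prod>e\<in>D. 1 - w e)"
    using assms(4) by (intro prod.cong) (auto simp: f_def g_def)
  finally show ?thesis .
qed

lemma sum_subset_weight: "finite Q \<Longrightarrow> (\<Sum>S\<in>Pow Q. subset_weight Q w S) = 1"
  using sum_subset_weight_cylinder[of Q "{}" "{}" w] by simp

text \<open>
  Variance plus squared bias; by independence only the diagonal pairs contribute to the variance.
\<close>

lemma sum_subset_weight_card_deviation:
  assumes "finite Q"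
  shows "(\<Sum>S\<in>Pow Q. subset_weight Q w S * (real (card S) - c)\<^sup>2)
    = (\<Sum>e\<in>Q. w e * (1 - w e)) + ((\<Sum>e\<in>Q. w e) - c)\<^sup>2"
proof -
  define \<mu> where "\<mu> = subset_weight Q w"
  define W where "W = (\<Sum>e\<in>Q. w e)"
  have card: "real (card S) = (\<Sum>e\<in>Q. of_bool ({e} \<subseteq> S))" if "S \<in> Pow Q" for S
  proof -
    have "(\<Sum>e\<in>Q. of_bool ({e} \<subseteq> S) :: real) = (\<Sum>e\<in>Q. if e \<in> S then 1 else 0)"
      by (intro sum.cong) auto
    also have "\<dots> = real (card (Q \<inter> S))" using assms by (simp flip: sum.inter_restrict)
    also have "Q \<inter> S = S" using that by auto
    finally show ?thesis by simp
  qed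
  have cyl: "(\<Sum>S\<in>Pow Q. \<mu> S * of_bool (C \<subseteq> S)) = (\<Prod>e\<in>C. w e)" if "C \<subseteq> Q" for C
    using sum_subset_weight_cylinder[OF assms that, of "{}" w] by (simp add: \<mu>_def)
  have 1: "(\<Sum>S\<in>Pow Q. \<mu> S * real (card S)) = W"
  proof -
    have "(\<Sum>S\<in>Pow Q. \<mu> S * real (card S)) = (\<Sum>S\<in>Pow Q. \<Sum>e\<in>Q. \<mu> S * of_bool ({e} \<subseteq> S))"
      by (intro sum.cong refl) (simp only: card sum_distrib_left)
    also have "\<dots> = (\<Sum>e\<in>Q. \<Sum>S\<in>Pow Q. \<mu> S * of_bool ({e} \<subseteq> S))" by (rule sum.swap)
    also have "\<dots> = (\<Sum>e\<in>Q. \<Prod>e\<in>{e}. w e)" by (intro sum.cong refl cyl) auto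
    finally show ?thesis by (simp add: W_def)
  qed
  have 2: "(\<Sum>S\<in>Pow Q. \<mu> S * (real (card S))\<^sup>2) = W\<^sup>2 + (\<Sum>e\<in>Q. w e * (1 - w e))"
  proof -
    have "(\<Sum>S\<in>Pow Q. \<mu> S * (real (card S))\<^sup>2) = (\<Sum>S\<in>Pow Q. \<Sum>e\<in>Q. \<Sum>f\<in>Q. \<mu> S * of_bool ({e, f} \<subseteq> S))"
    proof (rule sum.cong[OF refl])
      fix S assume S: "S \<in> Pow Q"
      have "(real (card S))\<^sup>2 = (\<Sum>e\<in>Q. \<Sum>f\<in>Q. of_bool ({e} \<subseteq> S) * of_bool ({f} \<subseteq> S))"
        by (simp only: power2_eq_square card[OF S] sum_product)
      also have "\<dots> = (\<Sum>e\<in>Q. \<Sum>f\<in>Q. of_bool ({e, f} \<subseteq> S))"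
        by (intro sum.cong refl) auto
      finally show "\<mu> S * (real (card S))\<^sup>2 = (\<Sum>e\<in>Q. \<Sum>f\<in>Q. \<mu> S * of_bool ({e, f} \<subseteq> S))"
        by (simp only: sum_distrib_left)
    qed
    also have "\<dots> = (\<Sum>e\<in>Q. \<Sum>f\<in>Q. \<Sum>S\<in>Pow Q. \<mu> S * of_bool ({e, f} \<subseteq> S))"
      by (subst sum.swap) (intro sum.cong refl sum.swap)
    also have "\<dots> = (\<Sum>e\<in>Q. \<Sum>f\<in>Q. w e * w f + (if f = e then w e * (1 - w e) else 0))"
    proof (rule sum.cong[OF refl], rule sum.cong[OF refl])
      fix e f assume ef: "e \<in> Q" "f \<in> Q"
      have "(\<Sum>S\<in>Pow Q. \<mu> S * of_bool ({e, f} \<subseteq> S)) = (\<Prod>e\<in>{e, f}. w e)"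
        using ef by (intro cyl) auto
      also have "\<dots> = w e * w f + (if f = e then w e * (1 - w e) else 0)"
        by (simp add: algebra_simps)
      finally show "(\<Sum>S\<in>Pow Q. \<mu> S * of_bool ({e, f} \<subseteq> S)) = w e * w f + (if f = e then w e * (1 - w e) else 0)" .
    qed
    also have "\<dots> = W\<^sup>2 + (\<Sum>e\<in>Q. w e * (1 - w e))"
      using assms by (simp add: sum.distrib W_def power2_eq_square sum_product)
    finally show ?thesis .
  qed
  have "(\<Sum>S\<in>Pow Q. \<mu> S * (real (card S) - c)\<^sup>2)
      = (\<Sum>S\<in>Pow Q. \<mu> S * (real (card S))\<^sup>2 - 2 * c * (\<mu> S * real (card S)) + c\<^sup>2 * \<mu> S)"
    by (intro sum.cong refl) (simp add: power2_eq_square algebra_simps)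
  also have "\<dots> = W\<^sup>2 + (\<Sum>e\<in>Q. w e * (1 - w e)) - 2 * c * W + c\<^sup>2 * 1"
    using sum_subset_weight[OF assms, of w, folded \<mu>_def]
    by (simp add: sum.distrib sum_subtractf 1 2 flip: sum_distrib_left)
  finally show ?thesis by (simp add: \<mu>_def W_def power2_eq_square algebra_simps)
qed

lemma exists_ge_weighted_average:
  fixes \<mu> \<Phi> :: "'s \<Rightarrow> real"
  assumes "finite X" "\<And>x. x \<in> X \<Longrightarrow> \<mu> x \<ge> 0" "sum \<mu> X = 1"
  shows "\<exists>x\<in>X. \<Phi> x \<ge> (\<Sum>x\<in>X. \<mu> x * \<Phi> x)"
proof -
  have ne: "X \<noteq> {}" using assms(3) by auto
  have "(\<Sum>x\<in>X. \<mu> x * \<Phi> x) \<le> (\<Sum>x\<in>X. \<mu> x * Max (\<Phi> ` X))"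
    using assms by (intro sum_mono mult_left_mono) auto
  also have "\<dots> = Max (\<Phi> ` X)" using assms(3) by (simp flip: sum_distrib_right)
  finally have "(\<Sum>x\<in>X. \<mu> x * \<Phi> x) \<le> Max (\<Phi> ` X)" .
  moreover have "Max (\<Phi> ` X) \<in> \<Phi> ` X" using ne assms(1) by (intro Max_in) auto
  then obtain x where "x \<in> X" "Max (\<Phi> ` X) = \<Phi> x" by blast
  ultimately show ?thesis by auto
qed

definition injections :: "'a set \<Rightarrow> 'b set \<Rightarrow> ('a \<Rightarrow> 'b) set" where
  "injections V A = {\<phi> \<in> V \<rightarrow>\<^sub>E A. inj_on \<phi> V}"

lemma finite_injections: "finite V \<Longrightarrow> finite A \<Longrightarrow> finite (injections V A)"
  unfolding injections_def by (auto intro: finite_subset[OF _ finite_PiE])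

lemma injections_insert:
  assumes "i \<notin> V"
  shows "injections (insert i V) A = (\<lambda>(x, u). x(i := u)) ` (SIGMA x:injections V A. A - x ` V)"
proof (intro equalityI subsetI)
  fix y assume y: "y \<in> injections (insert i V) A"
  define x where "x = y(i := undefined)"
  have eq: "\<And>v. v \<in> V \<Longrightarrow> x v = y v" using assms by (auto simp: x_def)
  have "x \<in> V \<rightarrow>\<^sub>E A"
    using y eq assms by (auto simp: injections_def PiE_def extensional_def x_def)
  moreover have "inj_on x V"
    using y eq by (auto simp: injections_def inj_on_def)
  moreover have "y i \<in> A - x ` V"
    using y eq assms by (auto simp: injections_def inj_on_def)
  moreover have "y = x(i := y i)" by (simp add: x_def)
  ultimately show "y \<in> (\<lambda>(x, u). x(i := u)) ` (SIGMA x:injections V A. A - x ` V)"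
    by (intro image_eqI[of _ _ "(x, y i)"]) (auto simp: injections_def)
next
  fix y assume "y \<in> (\<lambda>(x, u). x(i := u)) ` (SIGMA x:injections V A. A - x ` V)"
  then obtain x u where "x \<in> injections V A" "u \<in> A" "u \<notin> x ` V" "y = x(i := u)" by auto
  then show "y \<in> injections (insert i V) A"
    using assms by (auto simp: injections_def PiE_def extensional_def Pi_def inj_on_def)
qed

lemma card_injections:
  fixes V :: "'a set" and A :: "'b set"
  assumes "finite V" "finite A" "card V \<le> card A"
  shows "real (card (injections V A)) = falling_factorial (real (card A)) (card V)"
  using assms(1,3)
proof (induction V rule: finite_induct)
  case empty
  have "injections ({} :: 'a set) A = {\<lambda>_. undefined}" by (auto simp: injections_def)
  then show ?case by (simp add: falling_factorial_def)
next
  case (insert i V)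
  have "inj_on (\<lambda>(x, u). x(i := u)) (SIGMA x:injections V A. A - x ` V)"
  proof (rule inj_onI, clarify)
    fix x u y v assume xy: "x \<in> injections V A" "y \<in> injections V A" and eq: "x(i := u) = y(i := v)"
    have "x i = y i" using xy insert.hyps(2) by (auto simp: injections_def PiE_def extensional_def)
    then have "x = y" using eq by (metis fun_upd_triv fun_upd_upd)
    then show "x = y \<and> u = v" using eq by (metis fun_upd_same)
  qed
  then have "card (injections (insert i V) A) = card (SIGMA x:injections V A. A - x ` V)"
    unfolding injections_insert[OF insert.hyps(2)] by (rule card_image)
  also have "\<dots> = (\<Sum>x\<in>injections V A. card (A - x ` V))"
    using insert.hyps(1) assms(2) by (intro card_SigmaI) (auto simp: finite_injections)
  also have "\<dots> = (\<Sum>x\<in>injections V A. card A - card V)"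
  proof (intro sum.cong refl)
    fix x assume "x \<in> injections V A"
    then have "x ` V \<subseteq> A" "card (x ` V) = card V" by (auto simp: injections_def card_image)
    then show "card (A - x ` V) = card A - card V"
      using insert.hyps(1) by (subst card_Diff_subset) auto
  qed
  finally have "real (card (injections (insert i V) A)) = real (card (injections V A)) * (real (card A) - real (card V))"
    using insert.prems insert.hyps by (simp add: of_nat_diff)
  then show ?case using insert by (simp add: falling_factorial_def)
qed

lemma falling_factorial_bounds:
  assumes "k \<le> N" "N > 0"
  shows "0 < falling_factorial (real N) k" "falling_factorial (real N) k \<le> real N ^ k"
proof -
  show "0 < falling_factorial (real N) k"
    unfolding falling_factorial_def using assms by (intro prod_pos) auto
  have "falling_factorial (real N) k \<le> (\<Prod>i<k. real N)"
    unfolding falling_factorial_def using assms by (intro prod_mono) auto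
  then show "falling_factorial (real N) k \<le> real N ^ k" by simp
qed

lemma induced_embeddings_eq:
  assumes F: "finite_simple_graph F" and G: "finite_simple_graph G"
  shows "induced_embeddings F G = {\<phi> \<in> injections (verts F) (verts G).
     \<forall>e\<in>nsets (verts F) 2. e \<in> edges F \<longleftrightarrow> \<phi> ` e \<in> edges G}"
proof -
  have F1: "{a} \<notin> edges F" for a using F by (auto simp: finite_simple_graph_def nsets_def)
  have G1: "{a} \<notin> edges G" for a using G by (auto simp: finite_simple_graph_def nsets_def)
  have "(\<forall>a\<in>verts F. \<forall>b\<in>verts F. {a, b} \<in> edges F \<longleftrightarrow> {\<phi> a, \<phi> b} \<in> edges G) \<longleftrightarrow>
      (\<forall>e\<in>nsets (verts F) 2. e \<in> edges F \<longleftrightarrow> \<phi> ` e \<in> edges G)" for \<phi>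
  proof
    assume "\<forall>a\<in>verts F. \<forall>b\<in>verts F. {a, b} \<in> edges F \<longleftrightarrow> {\<phi> a, \<phi> b} \<in> edges G"
    then show "\<forall>e\<in>nsets (verts F) 2. e \<in> edges F \<longleftrightarrow> \<phi> ` e \<in> edges G" by (auto simp: nsets_2_eq)
  next
    assume *: "\<forall>e\<in>nsets (verts F) 2. e \<in> edges F \<longleftrightarrow> \<phi> ` e \<in> edges G"
    have "{a, b} \<in> edges F \<longleftrightarrow> {\<phi> a, \<phi> b} \<in> edges G" if "a \<in> verts F" "b \<in> verts F" for a b
    proof (cases "a = b")
      case True
      then show ?thesis using F1 G1 by simp
    next
      case False
      then show ?thesis using *[rule_format, of "{a, b}"] that by simp
    qed
    then show "\<forall>a\<in>verts F. \<forall>b\<in>verts F. {a, b} \<in> edges F \<longleftrightarrow> {\<phi> a, \<phi> b} \<in> edges G" by blast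
  qed
  then show ?thesis unfolding induced_embeddings_def injections_def by auto
qed

lemma induced_density_le_1:
  assumes F: "finite_simple_graph F" and G: "finite_simple_graph G" and le: "card (verts F) \<le> card (verts G)"
    and pos: "card (verts G) > 0"
  shows "induced_density F G \<le> 1" "induced_density F G \<ge> 0"
proof -
  have fin: "finite (verts F)" "finite (verts G)" using F G by (auto simp: finite_simple_graph_def)
  have "card (induced_embeddings F G) \<le> card (injections (verts F) (verts G))"
    unfolding induced_embeddings_eq[OF F G] using fin by (intro card_mono) (auto simp: finite_injections)
  then have "real (card (induced_embeddings F G)) \<le> falling_factorial (real (card (verts G))) (card (verts F))"
    using card_injections[OF fin le] by simp
  then show "induced_density F G \<le> 1" "induced_density F G \<ge> 0"
    using falling_factorial_bounds(1)[OF le pos] by (auto simp: induced_density_def)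
qed

text \<open>
  The right-hand side bounds from below the expectation of the left-hand side for the random graph with edge
  probabilities \<open>w\<close>, so some graph attains it. The penalty \<open>M\<close> controls both quantities at once:
  it forces the edge density of that graph close to \<open>p\<close> without a separate concentration argument.
\<close>

lemma weighted_graph_rounding:
  fixes F :: "'a graph" and A :: "'b set" and w :: "'b set \<Rightarrow> real"
  assumes F: "finite_simple_graph F" and A: "finite A" "card A \<ge> 2"
    and w: "\<And>e. e \<in> nsets A 2 \<Longrightarrow> 0 \<le> w e \<and> w e \<le> 1" and M: "M \<ge> 0"
  obtains G :: "'b graph" where "finite_simple_graph G" "verts G = A"
    and "induced_density F G - M * (edge_density G - p)\<^sup>2 \<ge>
      (\<Sum>\<phi>\<in>injections (verts F) A. \<Prod>e\<in>nsets (verts F) 2. if e \<in> edges F then w (\<phi> ` e) else 1 - w (\<phi> ` e))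
         / falling_factorial (real (card A)) (card (verts F))
      - M * (((\<Sum>e\<in>nsets A 2. w e) / real (card A choose 2) - p)\<^sup>2 + 1 / real (card A choose 2))"
proof -
  define Q where "Q = nsets A 2"
  define q where "q = real (card A choose 2)"
  define P where "P = nsets (verts F) 2"
  define I where "I = injections (verts F) A"
  define ff where "ff = falling_factorial (real (card A)) (card (verts F))"
  define \<mu> where "\<mu> = subset_weight Q w"
  define graph where "graph = (\<lambda>S. \<lparr>verts = A, edges = S\<rparr> :: 'b graph)"
  have finV: "finite (verts F)" and EP: "edges F \<subseteq> P" using F by (auto simp: finite_simple_graph_def P_def)
  have finQ: "finite Q" and finP: "finite P" using A finV by (auto simp: Q_def P_def finite_imp_finite_nsets)
  have finI: "finite I" using A finV by (simp add: I_def finite_injections)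
  have q: "real (card Q) = q" "q > 0" using A by (auto simp: Q_def q_def card_nsets)
  have simple: "finite_simple_graph (graph S)" if "S \<in> Pow Q" for S
    using that A(1) by (simp add: graph_def finite_simple_graph_def Q_def)
  have image_in: "\<phi> ` e \<in> Q" if "\<phi> \<in> I" "e \<in> P" for \<phi> e
  proof -
    have "e \<subseteq> verts F" "card e = 2" "inj_on \<phi> (verts F)" "\<phi> ` verts F \<subseteq> A"
      using that by (auto simp: P_def nsets_def I_def injections_def)
    then show ?thesis
      using finite_subset[OF _ finV, of e] by (auto simp: Q_def nsets_def card_image inj_on_subset)
  qed
  have inj_image: "inj_on ((`) \<phi>) P" if "\<phi> \<in> I" for \<phi>
    using that unfolding P_def I_def injections_def by (auto intro: inj_on_nsets)
  have expectation: "(\<Sum>S\<in>Pow Q. \<mu> S * induced_density F (graph S)) =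
      (\<Sum>\<phi>\<in>I. \<Prod>e\<in>P. if e \<in> edges F then w (\<phi> ` e) else 1 - w (\<phi> ` e)) / ff"
  proof -
    have count: "induced_density F (graph S) = (\<Sum>\<phi>\<in>I. of_bool (((`) \<phi>) ` edges F \<subseteq> S \<and> S \<inter> ((`) \<phi>) ` (P - edges F) = {})) / ff"
      if S: "S \<in> Pow Q" for S
    proof -
      have "induced_embeddings F (graph S) = {\<phi>\<in>I. ((`) \<phi>) ` edges F \<subseteq> S \<and> S \<inter> ((`) \<phi>) ` (P - edges F) = {}}"
        unfolding induced_embeddings_eq[OF F simple[OF S]] using EP by (auto simp: graph_def I_def P_def)
      moreover have "(\<Sum>\<phi>\<in>I. of_bool (Y \<phi>)) = real (card {\<phi>\<in>I. Y \<phi>})" for Y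
        using finI by (simp add: sum.If_cases of_bool_def Int_def)
      ultimately show ?thesis by (simp add: induced_density_def graph_def ff_def)
    qed
    have "(\<Sum>S\<in>Pow Q. \<mu> S * induced_density F (graph S)) =
      (\<Sum>S\<in>Pow Q. \<Sum>\<phi>\<in>I. \<mu> S * of_bool (((`) \<phi>) ` edges F \<subseteq> S \<and> S \<inter> ((`) \<phi>) ` (P - edges F) = {})) / ff"
      by (simp add: count sum_divide_distrib sum_distrib_left)
    also have "\<dots> = (\<Sum>\<phi>\<in>I. \<Sum>S\<in>Pow Q. \<mu> S * of_bool (((`) \<phi>) ` edges F \<subseteq> S \<and> S \<inter> ((`) \<phi>) ` (P - edges F) = {})) / ff"
      by (subst sum.swap) (rule refl)
    also have "\<dots> = (\<Sum>\<phi>\<in>I. \<Prod>e\<in>P. if e \<in> edges F then w (\<phi> ` e) else 1 - w (\<phi> ` e)) / ff"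
    proof (intro arg_cong2[where f = "(/)"] sum.cong refl)
      fix \<phi> assume \<phi>: "\<phi> \<in> I"
      have inj: "inj_on ((`) \<phi>) (edges F)" "inj_on ((`) \<phi>) (P - edges F)"
        using inj_image[OF \<phi>] EP by (auto intro: inj_on_subset)
      have "(\<Sum>S\<in>Pow Q. \<mu> S * of_bool (((`) \<phi>) ` edges F \<subseteq> S \<and> S \<inter> ((`) \<phi>) ` (P - edges F) = {}))
          = (\<Prod>e\<in>((`) \<phi>) ` edges F. w e) * (\<Prod>e\<in>((`) \<phi>) ` (P - edges F). 1 - w e)"
        unfolding \<mu>_def
      proof (rule sum_subset_weight_cylinder[OF finQ])
        show "((`) \<phi>) ` edges F \<subseteq> Q" "((`) \<phi>) ` (P - edges F) \<subseteq> Q" using image_in[OF \<phi>] EP by auto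
        show "((`) \<phi>) ` edges F \<inter> ((`) \<phi>) ` (P - edges F) = {}"
          using inj_image[OF \<phi>] EP by (auto simp: inj_on_def)
      qed
      also have "\<dots> = (\<Prod>e\<in>edges F. w (\<phi> ` e)) * (\<Prod>e\<in>P - edges F. 1 - w (\<phi> ` e))"
        using inj by (simp add: prod.reindex)
      also have "\<dots> = (\<Prod>e\<in>P \<inter> edges F. w (\<phi> ` e)) * (\<Prod>e\<in>P \<inter> - edges F. 1 - w (\<phi> ` e))"
        using EP by (simp add: Int_absorb1 Diff_eq)
      also have "\<dots> = (\<Prod>e\<in>P. if e \<in> edges F then w (\<phi> ` e) else 1 - w (\<phi> ` e))"
        using finP by (simp add: prod.If_cases Int_def Compl_eq)
      finally show "(\<Sum>S\<in>Pow Q. \<mu> S * of_bool (((`) \<phi>) ` edges F \<subseteq> S \<and> S \<inter> ((`) \<phi>) ` (P - edges F) = {})) =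
         (\<Prod>e\<in>P. if e \<in> edges F then w (\<phi> ` e) else 1 - w (\<phi> ` e))" .
    qed
    finally show ?thesis .
  qed
  have deviation: "(\<Sum>S\<in>Pow Q. \<mu> S * (edge_density (graph S) - p)\<^sup>2) \<le> ((\<Sum>e\<in>Q. w e) / q - p)\<^sup>2 + 1 / q"
  proof -
    have "(\<Sum>S\<in>Pow Q. \<mu> S * (edge_density (graph S) - p)\<^sup>2) = (\<Sum>S\<in>Pow Q. \<mu> S * (real (card S) - q * p)\<^sup>2) / q\<^sup>2"
      unfolding sum_divide_distrib
    proof (rule sum.cong[OF refl])
      fix S
      have "edge_density (graph S) - p = (real (card S) - q * p) / q"
        using q by (simp add: edge_density_def graph_def q_def field_simps)
      then show "\<mu> S * (edge_density (graph S) - p)\<^sup>2 = \<mu> S * (real (card S) - q * p)\<^sup>2 / q\<^sup>2"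
        by (simp add: power_divide)
    qed
    also have "\<dots> = ((\<Sum>e\<in>Q. w e * (1 - w e)) + ((\<Sum>e\<in>Q. w e) - q * p)\<^sup>2) / q\<^sup>2"
      unfolding \<mu>_def by (simp only: sum_subset_weight_card_deviation[OF finQ])
    also have "\<dots> = (\<Sum>e\<in>Q. w e * (1 - w e)) / q\<^sup>2 + ((\<Sum>e\<in>Q. w e) / q - p)\<^sup>2"
    proof -
      have "(\<Sum>e\<in>Q. w e) / q - p = ((\<Sum>e\<in>Q. w e) - q * p) / q" using q by (simp add: field_simps)
      then show ?thesis by (simp add: add_divide_distrib power_divide)
    qed
    also have "(\<Sum>e\<in>Q. w e * (1 - w e)) / q\<^sup>2 \<le> 1 / q"
    proof -
      have "(\<Sum>e\<in>Q. w e * (1 - w e)) \<le> (\<Sum>e\<in>Q. 1 * 1)"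
        using w by (intro sum_mono mult_mono) (auto simp: Q_def)
      then have "(\<Sum>e\<in>Q. w e * (1 - w e)) \<le> q" using q by simp
      then have "(\<Sum>e\<in>Q. w e * (1 - w e)) / q\<^sup>2 \<le> q / q\<^sup>2" by (rule divide_right_mono) simp
      then show ?thesis using q by (simp add: power2_eq_square)
    qed
    finally show ?thesis by simp
  qed
  define \<Phi> where "\<Phi> = (\<lambda>S. induced_density F (graph S) - M * (edge_density (graph S) - p)\<^sup>2)"
  obtain S where S: "S \<in> Pow Q" "\<Phi> S \<ge> (\<Sum>S\<in>Pow Q. \<mu> S * \<Phi> S)"
    using exists_ge_weighted_average[of "Pow Q" \<mu> \<Phi>] finQ sum_subset_weight[OF finQ, of w]
      subset_weight_nonneg[of _ Q w] w by (auto simp: \<mu>_def Q_def)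
  have "(\<Sum>S\<in>Pow Q. \<mu> S * \<Phi> S) = (\<Sum>S\<in>Pow Q. \<mu> S * induced_density F (graph S))
      - M * (\<Sum>S\<in>Pow Q. \<mu> S * (edge_density (graph S) - p)\<^sup>2)"
    by (simp add: \<Phi>_def right_diff_distrib sum_subtractf sum_distrib_left mult_ac)
  also have "\<dots> \<ge> (\<Sum>\<phi>\<in>I. \<Prod>e\<in>P. if e \<in> edges F then w (\<phi> ` e) else 1 - w (\<phi> ` e)) / ff
      - M * (((\<Sum>e\<in>Q. w e) / q - p)\<^sup>2 + 1 / q)"
    unfolding expectation using mult_left_mono[OF deviation M] by simp
  finally have "\<Phi> S \<ge> (\<Sum>\<phi>\<in>I. \<Prod>e\<in>P. if e \<in> edges F then w (\<phi> ` e) else 1 - w (\<phi> ` e)) / ff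
      - M * (((\<Sum>e\<in>Q. w e) / q - p)\<^sup>2 + 1 / q)" using S(2) by linarith
  then show ?thesis
    using simple[OF S(1)] by (intro that[of "graph S"]) (auto simp: \<Phi>_def I_def P_def Q_def q_def ff_def graph_def)
qed

section \<open>Graphs of growing order\<close>

lemma real_choose_2: "real (N choose 2) = real N * (real N - 1) / 2"
proof (cases N)
  case (Suc m)
  have "even (Suc m * m)" by auto
  then have "real (Suc m * m div 2) = real (Suc m * m) / 2"
    using real_of_nat_div[of 2 "Suc m * m"] by (simp only: of_nat_numeral)
  then show ?thesis by (simp add: Suc choose_two distrib_right)
qed simp

text \<open>
  The mean of the kernel over all ordered pairs of vertices, equal ones included, is exactly \<open>p\<close>.
  Discarding the diagonal costs at most \<open>1 / (N - 1)\<close>.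
\<close>

lemma tilted_kernel_pair_average:
  fixes \<kappa> :: "int \<Rightarrow> real"
  assumes \<kappa>: "\<And>a. 0 \<le> \<kappa> a" "\<And>a. \<kappa> a \<le> 1" and per: "\<And>a b. int r dvd a - b \<Longrightarrow> \<kappa> a = \<kappa> b"
    and mean: "(\<Sum>u<r. \<Sum>v<r. \<kappa> ((int u)\<^sup>2 + (int v)\<^sup>2 + 2 * (int k - 1) * int u * int v)) = (real r)\<^sup>2 * p"
    and p: "0 \<le> p" "p \<le> 1" and N: "N = n * r" "N \<ge> 2"
  shows "\<bar>(\<Sum>e\<in>nsets {..<N} 2. \<kappa> (pair_form k id e)) / real (N choose 2) - p\<bar> \<le> 1 / (real N - 1)"
proof -
  define form where "form = (\<lambda>u v. u\<^sup>2 + v\<^sup>2 + 2 * (int k - 1) * u * v)"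
  define s where "s = (\<Sum>u<N. \<kappa> (form (int u) (int u)))"
  define W where "W = (\<Sum>e\<in>nsets {..<N} 2. \<kappa> (pair_form k id e))"
  have perf: "\<kappa> (form a b) = \<kappa> (form a' b')" if "int r dvd a - a'" "int r dvd b - b'" for a a' b b'
  proof (rule per)
    have "form a b - form a' b' = (a - a') * (a + a' + 2 * (int k - 1) * b) + (b - b') * (b + b' + 2 * (int k - 1) * a')"
      by (simp add: form_def power2_eq_square algebra_simps)
    then show "int r dvd form a b - form a' b'" using that by simp
  qed
  have all: "(\<Sum>u<N. \<Sum>v<N. \<kappa> (form (int u) (int v))) = (real N)\<^sup>2 * p"
  proof -
    have "(\<Sum>u<N. \<Sum>v<N. \<kappa> (form (int u) (int v))) = (\<Sum>u<N. real n * (\<Sum>v<r. \<kappa> (form (int u) (int v))))"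
      unfolding N(1) by (intro sum.cong[OF refl] sum_periodic_blocks perf) auto
    also have "\<dots> = real n * (\<Sum>u<N. \<Sum>v<r. \<kappa> (form (int u) (int v)))"
      by (simp add: sum_distrib_left)
    also have "(\<Sum>u<N. \<Sum>v<r. \<kappa> (form (int u) (int v))) = real n * (\<Sum>u<r. \<Sum>v<r. \<kappa> (form (int u) (int v)))"
      unfolding N(1) by (rule sum_periodic_blocks) (intro sum.cong refl perf, auto)
    also have "(\<Sum>u<r. \<Sum>v<r. \<kappa> (form (int u) (int v))) = (real r)\<^sup>2 * p"
      using mean by (simp add: form_def)
    finally show ?thesis by (simp add: N(1) power2_eq_square)
  qed
  have "2 * W = (\<Sum>u<N. \<Sum>v\<in>{..<N} - {u}. \<kappa> (pair_form k id {u, v}))"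
    unfolding W_def by (rule sum_ordered_pairs[symmetric]) simp
  also have "\<dots> = (\<Sum>u<N. (\<Sum>v<N. \<kappa> (form (int u) (int v))) - \<kappa> (form (int u) (int u)))"
  proof (rule sum.cong[OF refl])
    fix u assume u: "u \<in> {..<N}"
    have "(\<Sum>v\<in>{..<N} - {u}. \<kappa> (pair_form k id {u, v})) = (\<Sum>v\<in>{..<N} - {u}. \<kappa> (form (int u) (int v)))"
      by (intro sum.cong refl) (auto simp: pair_form_doubleton form_def)
    then show "(\<Sum>v\<in>{..<N} - {u}. \<kappa> (pair_form k id {u, v})) = (\<Sum>v<N. \<kappa> (form (int u) (int v))) - \<kappa> (form (int u) (int u))"
      using u by (simp add: sum_diff1)
  qed
  also have "\<dots> = (real N)\<^sup>2 * p - s" by (simp only: sum_subtractf all s_def)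
  finally have W: "2 * W = (real N)\<^sup>2 * p - s" .
  have s: "0 \<le> s" "s \<le> real N"
    using \<kappa> sum_mono[of "{..<N}" "\<lambda>u. \<kappa> (form (int u) (int u))" "\<lambda>_. 1"]
    by (auto simp: s_def intro!: sum_nonneg)
  have N0: "real N > 0" "real N - 1 > 0" using N(2) by auto
  have "W / real (N choose 2) - p = (real N * p - s) / (real N * (real N - 1))"
  proof -
    have "W / real (N choose 2) = (2 * W) / (real N * (real N - 1))" unfolding real_choose_2 by simp
    then show ?thesis unfolding W using N0 by (simp add: field_simps power2_eq_square)
  qed
  also have "\<bar>\<dots>\<bar> \<le> real N / (real N * (real N - 1))"
  proof -
    have "0 \<le> real N * p" "real N * p \<le> real N" using p by (auto intro: mult_left_le)
    then have "\<bar>real N * p - s\<bar> \<le> real N" using s by linarith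
    moreover have pos: "real N * (real N - 1) > 0" using N0 by simp
    ultimately show ?thesis unfolding abs_divide abs_of_pos[OF pos] by (intro divide_right_mono) auto
  qed
  also have "\<dots> = 1 / (real N - 1)" using N0 by simp
  finally show ?thesis by (simp only: W_def)
qed

lemma sum_injections_lower_bound:
  fixes f :: "('a \<Rightarrow> 'b) \<Rightarrow> real"
  assumes "finite V" "finite A" "card V \<le> card A" and f: "\<And>x. f x \<le> 1"
  shows "(\<Sum>x\<in>injections V A. f x) \<ge> (\<Sum>x\<in>V \<rightarrow>\<^sub>E A. f x)
     - (real (card A) ^ card V - falling_factorial (real (card A)) (card V))"
proof -
  let ?X = "V \<rightarrow>\<^sub>E A"
  have fin: "finite ?X" using assms by (intro finite_PiE) auto
  have sub: "injections V A \<subseteq> ?X" by (auto simp: injections_def)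
  have "(\<Sum>x\<in>?X - injections V A. f x) \<le> (\<Sum>x\<in>?X - injections V A. 1)" by (intro sum_mono f)
  also have "\<dots> = real (card ?X) - real (card (injections V A))"
    using fin sub by (simp add: card_Diff_subset finite_subset card_mono of_nat_diff)
  also have "\<dots> = real (card A) ^ card V - falling_factorial (real (card A)) (card V)"
    using assms by (simp add: card_injections card_funcsetE)
  finally show ?thesis using sum.subset_diff[OF sub fin, of f] by linarith
qed

text \<open>
  Rounding with penalty \<open>N\<close>. The penalty tends to infinity, which forces the edge density to \<open>p\<close>, but
  it is small compared with \<open>N\<^sup>2\<close>, the inverse order of the variance and the squared bias of the edge
  density, so that the loss still tends to zero.
\<close>

lemma dense_tilted_graph_exists:
  fixes F :: "'a graph" and \<kappa> :: "int \<Rightarrow> real"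
  assumes F: "finite_simple_graph F" and p: "0 < p" "p < 1"
    and \<kappa>: "\<And>a. 0 \<le> \<kappa> a" "\<And>a. \<kappa> a \<le> 1" and per: "\<And>a b. int r dvd a - b \<Longrightarrow> \<kappa> a = \<kappa> b"
    and mean: "(\<Sum>u<r. \<Sum>v<r. \<kappa> ((int u)\<^sup>2 + (int v)\<^sup>2 + 2 * (int (card (verts F)) - 1) * int u * int v)) = (real r)\<^sup>2 * p"
    and copies: "(\<Sum>x\<in>verts F \<rightarrow>\<^sub>E {..<n * r}. \<Prod>e\<in>nsets (verts F) 2.
           if e \<in> edges F then \<kappa> (pair_form (card (verts F)) x e) else 1 - \<kappa> (pair_form (card (verts F)) x e))
         \<ge> real (n * r) ^ card (verts F) * y"
    and N: "N = n * r" "N \<ge> 2" "card (verts F) \<le> N"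
  shows "\<exists>G :: nat graph. finite_simple_graph G \<and> card (verts G) = N \<and>
    induced_density F G - real N * (edge_density G - p)\<^sup>2 \<ge>
      y - (1 - falling_factorial (real N) (card (verts F)) / real N ^ card (verts F))
        - (real N * (1 / (real N - 1))\<^sup>2 + 2 / (real N - 1))"
proof -
  define V where "V = verts F"
  define k where "k = card V"
  define P where "P = nsets V 2"
  define ff where "ff = falling_factorial (real N) k"
  define w where "w = (\<lambda>e. \<kappa> (pair_form k id e))"
  define h where "h = (\<lambda>x. \<Prod>e\<in>P. if e \<in> edges F then \<kappa> (pair_form k x e) else 1 - \<kappa> (pair_form k x e))"
  define g where "g = (\<lambda>x. \<Prod>e\<in>P. if e \<in> edges F then w (x ` e) else 1 - w (x ` e))"
  have finV: "finite V" using F by (simp add: finite_simple_graph_def V_def)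
  have h01: "0 \<le> h x" "h x \<le> 1" for x
    unfolding h_def using \<kappa> by (auto intro!: prod_nonneg prod_le_1)
  have hg: "g x = h x" if "x \<in> injections V {..<N}" for x
    unfolding g_def h_def w_def
  proof (intro prod.cong refl)
    fix e assume "e \<in> P"
    then have "inj_on x e" using that by (auto simp: P_def nsets_def injections_def intro: inj_on_subset)
    then show "(if e \<in> edges F then \<kappa> (pair_form k id (x ` e)) else 1 - \<kappa> (pair_form k id (x ` e))) =
        (if e \<in> edges F then \<kappa> (pair_form k x e) else 1 - \<kappa> (pair_form k x e))"
      by (simp add: pair_form_image)
  qed
  have ff: "0 < ff" "ff \<le> real N ^ k"
  proof -
    have "N > 0" using N(2) by linarith
    then show "0 < ff" "ff \<le> real N ^ k"
      using falling_factorial_bounds[OF N(3)] by (simp_all add: ff_def k_def V_def)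
  qed
  have N0: "real N > 0" "real N - 1 > 0" using N(2) by auto
  have w01: "0 \<le> w e \<and> w e \<le> 1" for e using \<kappa> by (simp add: w_def)
  obtain G :: "nat graph" where G: "finite_simple_graph G" "verts G = {..<N}"
    and dens: "induced_density F G - real N * (edge_density G - p)\<^sup>2 \<ge>
      (\<Sum>x\<in>injections V {..<N}. g x) / ff
      - real N * (((\<Sum>e\<in>nsets {..<N} 2. w e) / real (N choose 2) - p)\<^sup>2 + 1 / real (N choose 2))"
    unfolding V_def g_def P_def ff_def k_def
    by (rule weighted_graph_rounding[OF F finite_lessThan[of N] _ w01, where M = "real N" and p = p, unfolded card_lessThan])
       (use N(2) in auto)
  have main: "(\<Sum>x\<in>injections V {..<N}. g x) / ff \<ge> y - (1 - ff / real N ^ k)"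
  proof -
    \<comment> \<open>The kernel average runs over all maps; the non-injective ones carry at most their number.\<close>
    have "real N ^ k * y - (real N ^ k - ff) \<le> (\<Sum>x\<in>V \<rightarrow>\<^sub>E {..<N}. h x) - (real N ^ k - ff)"
      using copies unfolding h_def N(1) k_def P_def V_def by simp
    also have "\<dots> \<le> (\<Sum>x\<in>injections V {..<N}. h x)"
      using sum_injections_lower_bound[of V "{..<N}" h] finV N(3) h01 by (simp add: ff_def k_def V_def)
    also have "\<dots> = (\<Sum>x\<in>injections V {..<N}. g x)" using hg by (intro sum.cong) auto
    finally have 1: "real N ^ k * y - (real N ^ k - ff) \<le> (\<Sum>x\<in>injections V {..<N}. g x)" .
    have 2: "(\<Sum>x\<in>injections V {..<N}. g x) \<ge> 0" using hg h01 by (intro sum_nonneg) auto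
    have "y - (1 - ff / real N ^ k) = (real N ^ k * y - (real N ^ k - ff)) / real N ^ k"
      using N0 by (simp add: field_simps)
    also have "\<dots> \<le> (\<Sum>x\<in>injections V {..<N}. g x) / real N ^ k"
      using 1 by (intro divide_right_mono) auto
    also have "\<dots> \<le> (\<Sum>x\<in>injections V {..<N}. g x) / ff"
      using 2 ff N0 by (intro divide_left_mono mult_pos_pos) auto
    finally show ?thesis .
  qed
  have err: "real N * (((\<Sum>e\<in>nsets {..<N} 2. w e) / real (N choose 2) - p)\<^sup>2 + 1 / real (N choose 2))
      \<le> real N * (1 / (real N - 1))\<^sup>2 + 2 / (real N - 1)"
  proof -
    have "\<bar>(\<Sum>e\<in>nsets {..<N} 2. w e) / real (N choose 2) - p\<bar> \<le> 1 / (real N - 1)"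
      unfolding w_def using p \<kappa> per mean N by (intro tilted_kernel_pair_average) (auto simp: k_def V_def)
    then have 1: "((\<Sum>e\<in>nsets {..<N} 2. w e) / real (N choose 2) - p)\<^sup>2 \<le> (1 / (real N - 1))\<^sup>2"
      by (metis abs_ge_zero power2_abs power_mono)
    have 2: "real N * (1 / real (N choose 2)) = 2 / (real N - 1)" using N0 by (simp add: real_choose_2)
    have "real N * (((\<Sum>e\<in>nsets {..<N} 2. w e) / real (N choose 2) - p)\<^sup>2 + 1 / real (N choose 2)) =
      real N * ((\<Sum>e\<in>nsets {..<N} 2. w e) / real (N choose 2) - p)\<^sup>2 + 2 / (real N - 1)"
      unfolding 2[symmetric] by (rule distrib_left)
    then show ?thesis using mult_left_mono[OF 1, of "real N"] by simp
  qed
  show ?thesis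
    using G dens main err unfolding ff_def k_def V_def by (intro exI[of _ G]) auto
qed

lemma falling_factorial_ratio_tendsto:
  assumes "filterlim N at_top sequentially"
  shows "(\<lambda>n. falling_factorial (real (N n)) k / real (N n) ^ k) \<longlonglongrightarrow> 1"
proof -
  have top: "filterlim (\<lambda>n. real (N n)) at_top sequentially"
    using filterlim_compose[OF filterlim_real_sequentially assms] .
  have pos: "eventually (\<lambda>n. real (N n) > 0) sequentially"
    using filterlim_at_top_dense[THEN iffD1, OF top] by blast
  have "(\<lambda>n. \<Prod>i<k. (1 - real i / real (N n))) \<longlonglongrightarrow> (\<Prod>i<k. (1 - 0))"
    by (intro tendsto_intros tendsto_divide_0[OF tendsto_const] filterlim_at_top_imp_at_infinity top)
  moreover have "eventually (\<lambda>n. (\<Prod>i<k. (1 - real i / real (N n))) =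
      falling_factorial (real (N n)) k / real (N n) ^ k) sequentially"
    using pos
  proof eventually_elim
    case (elim n)
    have "falling_factorial (real (N n)) k / real (N n) ^ k = (\<Prod>i<k. (real (N n) - real i) / real (N n))"
      by (simp add: falling_factorial_def prod_dividef)
    also have "\<dots> = (\<Prod>i<k. (1 - real i / real (N n)))"
      using elim by (intro prod.cong refl) (simp add: field_simps)
    finally show ?case by simp
  qed
  ultimately show ?thesis using tendsto_cong by fastforce
qed

text \<open>
  For unbounded sets of reals the supremum is a default value, so this is needed to compare a limit
  density with \<open>inducibility\<close>.
\<close>

lemma bdd_above_limit_induced_densities:
  assumes F: "finite_simple_graph F"
  shows "bdd_above (limit_induced_densities F p)"
proof (rule bdd_aboveI)
  fix y assume "y \<in> limit_induced_densities F p"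
  then obtain G :: "nat \<Rightarrow> nat graph" where G: "\<And>n. finite_simple_graph (G n)"
    "filterlim (\<lambda>n. card (verts (G n))) at_top sequentially"
    "(\<lambda>n. induced_density F (G n)) \<longlonglongrightarrow> y"
    unfolding limit_induced_densities_def by blast
  have "eventually (\<lambda>n. card (verts (G n)) \<ge> Suc (card (verts F))) sequentially"
    using G(2) by (simp add: filterlim_at_top)
  then have "eventually (\<lambda>n. induced_density F (G n) \<le> 1) sequentially"
    by eventually_elim (rule induced_density_le_1(1)[OF F G(1)], auto)
  then show "y \<le> 1" using G(3) by (intro tendsto_upperbound[OF G(3)]) auto
qed

text \<open>
  Induced densities lie in \<open>[0, 1]\<close>, so a monotone subsequence of them converges.
\<close>

lemma limit_induced_density_exists:
  fixes G :: "nat \<Rightarrow> nat graph"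
  assumes F: "finite_simple_graph F" and G: "\<And>n. finite_simple_graph (G n)"
    and top: "filterlim (\<lambda>n. card (verts (G n))) at_top sequentially"
    and p: "(\<lambda>n. edge_density (G n)) \<longlonglongrightarrow> p"
    and ge: "\<And>n. induced_density F (G n) \<ge> b n" "b \<longlonglongrightarrow> y"
  obtains z where "z \<in> limit_induced_densities F p" "z \<ge> y"
proof -
  obtain f :: "nat \<Rightarrow> nat" where f: "strict_mono f" "monoseq (\<lambda>n. induced_density F (G (f n)))"
    using seq_monosub[of "\<lambda>n. induced_density F (G n)"] by blast
  have sub: "filterlim f at_top sequentially" using f(1) by (rule filterlim_subseq)
  have "eventually (\<lambda>n. card (verts (G n)) \<ge> Suc (card (verts F))) sequentially"
    using top by (simp add: filterlim_at_top)
  then have "eventually (\<lambda>n. norm (induced_density F (G n)) \<le> 1) sequentially"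
  proof eventually_elim
    case (elim n)
    then show ?case using induced_density_le_1[OF F G[of n]] by auto
  qed
  then have "eventually (\<lambda>n. norm (induced_density F (G (f n))) \<le> 1) sequentially"
    using sub by (rule eventually_compose_filterlim)
  then have "Bseq (\<lambda>n. induced_density F (G (f n)))" by (rule BfunI)
  then obtain z where z: "(\<lambda>n. induced_density F (G (f n))) \<longlonglongrightarrow> z"
    using Bseq_monoseq_convergent[OF _ f(2)] convergent_def by blast
  show ?thesis
  proof (rule that)
    show "z \<in> limit_induced_densities F p"
      unfolding limit_induced_densities_def
      using G z filterlim_compose[OF top sub] filterlim_compose[OF p sub]
      by (intro CollectI exI[of _ "\<lambda>n. G (f n)"]) auto
    show "z \<ge> y"
      using filterlim_compose[OF ge(2) sub] z ge(1) by (intro LIMSEQ_le[of "\<lambda>n. b (f n)" y _ z]) auto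
  qed
qed

theorem theorem1p1:
  fixes F :: "'a graph" and p :: real
  assumes "finite_simple_graph F"
    and "card (verts F) \<ge> 3"
    and "0 < p" and "p < 1"
  shows "inducibility F p > rand_density F p"
proof -
  define k where "k = card (verts F)"
  obtain r \<kappa> \<gamma> where r: "r > 0" and \<gamma>: "\<gamma> > 0" and \<kappa>: "\<And>a. 0 \<le> \<kappa> a" "\<And>a. \<kappa> a \<le> 1"
    and per: "\<And>a b. int r dvd a - b \<Longrightarrow> \<kappa> a = \<kappa> b"
    and mean: "(\<Sum>u<r. \<Sum>v<r. \<kappa> ((int u)\<^sup>2 + (int v)\<^sup>2 + 2 * (int (card (verts F)) - 1) * int u * int v)) = (real r)\<^sup>2 * p"
    and copies: "\<And>n. (\<Sum>x\<in>verts F \<rightarrow>\<^sub>E {..<n * r}. \<Prod>e\<in>nsets (verts F) 2.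
           if e \<in> edges F then \<kappa> (pair_form (card (verts F)) x e) else 1 - \<kappa> (pair_form (card (verts F)) x e))
         \<ge> real (n * r) ^ card (verts F) * (rand_density F p + \<gamma>)"
    by (rule tilted_kernel_exists[OF assms]) (rule that)
  \<comment> \<open>Multiples of \<open>r\<close>, so that all residues are equally frequent; the shift by \<open>k\<close> leaves room for injections.\<close>
  define N where "N = (\<lambda>n. (n + k) * r)"
  have N_ge: "n + k \<le> N n" for n using r by (simp add: N_def)
  have N2: "2 \<le> N n" "k \<le> N n" for n using N_ge[of n] assms(2) by (auto simp: k_def)
  have N_top: "filterlim N at_top sequentially"
    unfolding filterlim_at_top eventually_sequentially using N_ge by (metis add_leD1 le_trans)
  define \<delta> where "\<delta> = (\<lambda>n. (1 - falling_factorial (real (N n)) k / real (N n) ^ k)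
     + (real (N n) * (1 / (real (N n) - 1))\<^sup>2 + 2 / (real (N n) - 1)))"
  have "\<exists>G :: nat graph. finite_simple_graph G \<and> card (verts G) = N n \<and>
     induced_density F G - real (N n) * (edge_density G - p)\<^sup>2 \<ge> rand_density F p + \<gamma> - \<delta> n" for n
    using dense_tilted_graph_exists[OF assms(1,3,4) \<kappa> per mean copies, of "N n" "n + k"] N2[of n]
    by (simp add: N_def \<delta>_def k_def algebra_simps)
  then obtain G :: "nat \<Rightarrow> nat graph" where G: "\<And>n. finite_simple_graph (G n)" "\<And>n. card (verts (G n)) = N n"
    and dens: "\<And>n. induced_density F (G n) - real (N n) * (edge_density (G n) - p)\<^sup>2 \<ge> rand_density F p + \<gamma> - \<delta> n"
    by metis
  have Nr_top: "filterlim (\<lambda>n. real (N n)) at_top sequentially"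
    using filterlim_compose[OF filterlim_real_sequentially N_top] .
  have N1_top: "filterlim (\<lambda>n. real (N n) - 1) at_top sequentially"
    using filterlim_tendsto_add_at_top[OF tendsto_const[of "-1"] Nr_top] by simp
  have inv: "(\<lambda>n. 1 / (real (N n) - 1)) \<longlonglongrightarrow> 0"
    by (intro tendsto_divide_0[OF tendsto_const] filterlim_at_top_imp_at_infinity N1_top)
  have \<delta>: "\<delta> \<longlonglongrightarrow> 0"
  proof -
    have eq: "real (N n) * (1 / (real (N n) - 1))\<^sup>2 + 2 / (real (N n) - 1) =
        3 * (1 / (real (N n) - 1)) + (1 / (real (N n) - 1))\<^sup>2" for n
    proof -
      define t where "t = real (N n) - 1"
      have "t > 0" "real (N n) = t + 1" using N2(1)[of n] by (auto simp: t_def)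
      then show ?thesis by (simp add: field_simps power2_eq_square)
    qed
    have "(\<lambda>n. (1 - falling_factorial (real (N n)) k / real (N n) ^ k)
     + (3 * (1 / (real (N n) - 1)) + (1 / (real (N n) - 1))\<^sup>2)) \<longlonglongrightarrow> (1 - 1) + (3 * 0 + 0\<^sup>2)"
      by (intro tendsto_intros falling_factorial_ratio_tendsto N_top inv)
    then show ?thesis by (simp add: \<delta>_def eq)
  qed
  have rand: "rand_density F p \<ge> 0"
    using assms(3,4) by (simp add: rand_density_def)
  have edge: "(\<lambda>n. edge_density (G n)) \<longlonglongrightarrow> p"
  proof -
    have bound: "(edge_density (G n) - p)\<^sup>2 \<le> (1 + \<delta> n) * (1 / real (N n))" for n
    proof -
      have "induced_density F (G n) \<le> 1"
        using N2[of n] by (intro induced_density_le_1(1)[OF assms(1) G(1)]) (auto simp: G(2) k_def)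
      then have "real (N n) * (edge_density (G n) - p)\<^sup>2 \<le> 1 + \<delta> n"
        using dens[of n] rand \<gamma> by linarith
      then show ?thesis using N2[of n] by (simp add: field_simps)
    qed
    have "(\<lambda>n. 1 / real (N n)) \<longlonglongrightarrow> 0"
      by (intro tendsto_divide_0[OF tendsto_const] filterlim_at_top_imp_at_infinity Nr_top)
    then have "(\<lambda>n. (1 + \<delta> n) * (1 / real (N n))) \<longlonglongrightarrow> (1 + 0) * 0"
      by (intro tendsto_intros \<delta>)
    then have upper: "(\<lambda>n. (1 + \<delta> n) * (1 / real (N n))) \<longlonglongrightarrow> 0" by simp
    have "(\<lambda>n. (edge_density (G n) - p)\<^sup>2) \<longlonglongrightarrow> 0"
      by (rule tendsto_sandwich[OF always_eventually always_eventually tendsto_const upper]) (simp, use bound in blast)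
    then have "(\<lambda>n. sqrt ((edge_density (G n) - p)\<^sup>2)) \<longlonglongrightarrow> sqrt 0"
      by (intro tendsto_real_sqrt)
    then have "(\<lambda>n. edge_density (G n) - p) \<longlonglongrightarrow> 0"
      by (simp add: tendsto_rabs_zero_iff)
    then show ?thesis by (simp add: LIM_zero_iff)
  qed
  have limit: "(\<lambda>n. rand_density F p + \<gamma> - \<delta> n) \<longlonglongrightarrow> rand_density F p + \<gamma> - 0"
    by (intro tendsto_intros \<delta>)
  have lower: "induced_density F (G n) \<ge> rand_density F p + \<gamma> - \<delta> n" for n
  proof -
    have "real (N n) * (edge_density (G n) - p)\<^sup>2 \<ge> 0" by simp
    then show ?thesis using dens[of n] by linarith
  qed
  have order: "filterlim (\<lambda>n. card (verts (G n))) at_top sequentially" using N_top by (simp add: G(2))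
  obtain z where z: "z \<in> limit_induced_densities F p" "z \<ge> rand_density F p + \<gamma> - 0"
    by (rule limit_induced_density_exists[OF assms(1) G(1) order edge lower limit]) (rule that)
  have "z \<le> inducibility F p"
    unfolding inducibility_def using z(1) bdd_above_limit_induced_densities[OF assms(1)] by (rule cSup_upper)
  then show ?thesis using z(2) \<gamma> by linarith
qed

end
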